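(* Let $d\in\mathbb{N}$ and let $\mu$ be a Borel probability measure on $\mathbb{R}^d$ whose characteristic function vanishes nowhere. Then the family $\{f*\mu:f\in U_b(\mathbb{R}^d)\}\subset U_b(\mathbb{R}^d)$ is dense in $U_b(\mathbb{R}^d)$ in the topology of uniform convergence.
   Context: $U_b(\mathbb{R}^d)$ is the space of bounded uniformly continuous real-valued functions on $\mathbb{R}^d$. $(f*\mu)(x)=\int f(x-y)\,\mu(dy)$. *)

theory Defs
  imports "HOL-Probability.Probability"
begin

definition U_b :: "('a::euclidean_space \<Rightarrow> real) set" where
  "U_b = {f. bounded (range f) \<and> uniformly_continuous_on UNIV f}"

definition conv_measure :: "('a::euclidean_space \<Rightarrow> real) \<Rightarrow> 'a measure \<Rightarrow> 'a \<Rightarrow> real" where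
  "conv_measure f \<mu> x = (LINT y|\<mu>. f (x - y))"

(* The library constant char covers only measures on the real line. *)
definition char_fun :: "'a::euclidean_space measure \<Rightarrow> 'a \<Rightarrow> complex" where
  "char_fun \<mu> t = (CLINT x|\<mu>. iexp (t \<bullet> x))"

(* funspace UNIV euclidean_metric consists of the bounded functions on the whole
   space, with the supremum metric; its subspace topology on U_b is uniform convergence. *)
definition U_b_topology :: "('a::euclidean_space \<Rightarrow> real) topology" where
  "U_b_topology = mtopology_of (submetric (funspace UNIV euclidean_metric) U_b)"

lemma topspace_U_b_topology: "topspace U_b_topology = U_b"
  by (auto simp: U_b_topology_def U_b_def Met_TC.fspace_def Met_TC.mbounded_alt
      bounded_two_points)

lemma mdist_U_b:
  fixes f g :: "'a::euclidean_space \<Rightarrow> real"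
  assumes "f \<in> U_b" "g \<in> U_b"
  shows "mdist (submetric (funspace UNIV euclidean_metric) U_b) f g = (SUP x. \<bar>f x - g x\<bar>)"
proof -
  have "f \<in> Met_TC.fspace UNIV" "g \<in> Met_TC.fspace UNIV"
    using assms by (auto simp: U_b_def Met_TC.fspace_def Met_TC.mbounded_alt bounded_two_points)
  then show ?thesis
    by (simp add: Met_TC.fdist_def dist_real_def)
qed

end

theory Submission
  imports Defs
begin

text \<open>
  This is Wiener's Tauberian argument, carried out with convolution operators on bounded uniformly
  continuous functions instead of in \<open>L\<^sup>1\<close>. If the spectrum of \<open>g\<close> lies within \<open>a\<close> of the frequency
  \<open>t\<close> in every coordinate, then \<open>g (x - y)\<close> is close to \<open>cis (- t \<bullet> y) * g x\<close>, uniformly in \<open>x\<close>, as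
  long as \<open>a * y\<close> is small; so \<open>g * \<mu>\<close> is close to \<open>\<lambda> g\<close>, where \<open>\<lambda> \<noteq> 0\<close> is a value of the
  characteristic function, and a Neumann series inverts convolution with \<open>\<mu>\<close> on such functions. An
  arbitrary \<open>f\<close> is approximated uniformly by its Fejer means of order \<open>N\<close>. The Fejer kernel of order
  \<open>m a\<close> is a finite sum of modulated Fejer kernels of order \<open>a\<close>, so these means are finite sums of
  functions with spectrum in small cubes, on which \<open>\<lambda>\<close> is bounded away from zero by compactness.
\<close>

section \<open>Bounded uniformly continuous functions and convolution operators\<close>

text \<open>Complex values are needed because the modulated kernels are complex; taking real parts
  leads back to \<open>U_b\<close> at the end.\<close>

definition BUC :: "('a::euclidean_space \<Rightarrow> complex) set" where
  "BUC = {f. bounded (range f) \<and> uniformly_continuous_on UNIV f}"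

text \<open>One operator covers both convolutions in use: with \<mu> (\<open>w = 1\<close>,
  \<open>Y y = y\<close>) and with a kernel \<open>w\<close> on the real line acting in a direction
  \<open>b\<close> (\<open>Y s = s *\<^sub>R b\<close>).\<close>

definition cavg :: "'s measure \<Rightarrow> ('s \<Rightarrow> complex) \<Rightarrow> ('s \<Rightarrow> 'a::euclidean_space)
    \<Rightarrow> ('a \<Rightarrow> complex) \<Rightarrow> 'a \<Rightarrow> complex" where
  "cavg M w Y f x = (LINT s|M. w s * f (x - Y s))"

lemma BUC_bound:
  assumes "f \<in> BUC"
  obtains B where "0 \<le> B" "\<And>x. norm (f x) \<le> B"
proof -
  from assms obtain B where B: "\<And>x. norm (f x) \<le> B"
    by (auto simp: BUC_def bounded_iff)
  moreover have "0 \<le> B" using B[of 0] norm_ge_zero order_trans by blast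
  ultimately show ?thesis using that by blast
qed

lemma BUC_measurable: "f \<in> BUC \<Longrightarrow> f \<in> borel_measurable borel"
  by (auto simp: BUC_def intro: borel_measurable_continuous_onI uniformly_continuous_imp_continuous)

lemma BUC_uniform:
  assumes "f \<in> BUC" "0 < e"
  obtains d where "0 < d" "\<And>x y. dist x y < d \<Longrightarrow> norm (f x - f y) < e"
  using assms unfolding BUC_def uniformly_continuous_on_def dist_norm by blast

lemma BUC_I:
  assumes "\<And>x. norm (f x) \<le> B"
    and "\<And>e. 0 < e \<Longrightarrow> \<exists>d>0. \<forall>x y. dist x y < d \<longrightarrow> norm (f x - f y) < e"
  shows "f \<in> BUC"
  unfolding BUC_def
proof (intro CollectI conjI)
  show "bounded (range f)"
    using assms(1) by (auto simp: bounded_iff)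
  show "uniformly_continuous_on UNIV f"
    unfolding uniformly_continuous_on_def
  proof (intro allI impI)
    fix e :: real assume "0 < e"
    from assms(2)[OF this] obtain d where "d > 0" "\<forall>x y. dist x y < d \<longrightarrow> norm (f x - f y) < e" 
      by blast
    then show "\<exists>d>0. \<forall>x\<in>UNIV. \<forall>x'\<in>UNIV. dist x' x < d \<longrightarrow> dist (f x') (f x) < e"
      by (auto simp: dist_norm)
  qed
qed

lemma BUC_add: "f \<in> BUC \<Longrightarrow> g \<in> BUC \<Longrightarrow> (\<lambda>x. f x + g x) \<in> BUC"
  by (auto simp: BUC_def bounded_plus_comp intro: uniformly_continuous_on_add)

lemma BUC_cmult: "f \<in> BUC \<Longrightarrow> (\<lambda>x. c * f x) \<in> BUC"
  using bounded_linear_image[OF _ bounded_linear_mult_right[of c], of "range f"]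
    bounded_linear.uniformly_continuous_on[OF bounded_linear_mult_right[of c], of UNIV f]
  by (simp add: BUC_def image_image)

lemma BUC_const: "(\<lambda>x. c) \<in> BUC"
  by (simp add: BUC_def uniformly_continuous_on_const image_constant_conv)

lemma BUC_diff: "f \<in> BUC \<Longrightarrow> g \<in> BUC \<Longrightarrow> (\<lambda>x. f x - g x) \<in> BUC"
  using BUC_add[OF _ BUC_cmult[of g "-1"], of f] by simp

section \<open>Linearity, norm bounds and Fubini for convolution operators\<close>

lemma cavg_integrable:
  assumes [measurable]: "integrable M w" "Y \<in> borel_measurable M" and "f \<in> BUC"
  shows "integrable M (\<lambda>s. w s * f (x - Y s))"
proof -
  note [measurable] = BUC_measurable[OF assms(3)]
  obtain B where B: "\<And>x. norm (f x) \<le> B" using BUC_bound assms by blast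
  show ?thesis
  proof (rule Bochner_Integration.integrable_bound)
    show "integrable M (\<lambda>s. w s * of_real B)" using assms by simp
    show "(\<lambda>s. w s * f (x - Y s)) \<in> borel_measurable M" by measurable
    show "AE s in M. norm (w s * f (x - Y s)) \<le> norm (w s * of_real B)"
      using B by (auto simp: norm_mult intro!: mult_left_mono order_trans[OF B])
  qed
qed

lemma cavg_add:
  assumes "integrable M w" "Y \<in> borel_measurable M" "f \<in> BUC" "g \<in> BUC"
  shows "cavg M w Y (\<lambda>x. f x + g x) x = cavg M w Y f x + cavg M w Y g x"
  using cavg_integrable[OF assms(1,2,3)] cavg_integrable[OF assms(1,2,4)]
  by (simp add: cavg_def distrib_left)

lemma cavg_diff:
  assumes "integrable M w" "Y \<in> borel_measurable M" "f \<in> BUC" "g \<in> BUC"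
  shows "cavg M w Y (\<lambda>x. f x - g x) x = cavg M w Y f x - cavg M w Y g x"
  using cavg_integrable[OF assms(1,2,3)] cavg_integrable[OF assms(1,2,4)]
  by (simp add: cavg_def right_diff_distrib)

lemma cavg_cmult: "cavg M w Y (\<lambda>x. c * f x) x = c * cavg M w Y f x"
proof -
  have "cavg M w Y (\<lambda>x. c * f x) x = (LINT s|M. c * (w s * f (x - Y s)))"
    by (simp add: cavg_def mult_ac)
  then show ?thesis by (simp add: cavg_def)
qed

lemma cavg_sum:
  assumes "integrable M w" "Y \<in> borel_measurable M" "\<And>i. i \<in> I \<Longrightarrow> f i \<in> BUC"
  shows "cavg M w Y (\<lambda>x. \<Sum>i\<in>I. f i x) x = (\<Sum>i\<in>I. cavg M w Y (f i) x)"
  unfolding cavg_def sum_distrib_left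
  by (rule Bochner_Integration.integral_sum) (use assms cavg_integrable in blast)

lemma cavg_weight_sum:
  assumes "\<And>i. i \<in> I \<Longrightarrow> integrable M (w i)" "Y \<in> borel_measurable M" "f \<in> BUC"
  shows "cavg M (\<lambda>s. \<Sum>i\<in>I. w i s) Y f x = (\<Sum>i\<in>I. cavg M (w i) Y f x)"
  unfolding cavg_def sum_distrib_right
  by (rule Bochner_Integration.integral_sum) (use assms cavg_integrable in blast)

lemma cavg_norm_le:
  assumes "integrable M w" "Y \<in> borel_measurable M" "f \<in> BUC"
    and B: "\<And>x. norm (f x) \<le> B"
  shows "norm (cavg M w Y f x) \<le> (LINT s|M. norm (w s)) * B"
proof -
  have "norm (cavg M w Y f x) \<le> (LINT s|M. norm (w s * f (x - Y s)))"
    unfolding cavg_def by (rule integral_norm_bound)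
  also have "\<dots> \<le> (LINT s|M. norm (w s) * B)"
    using B assms(1) integrable_norm[OF cavg_integrable[OF assms(1-3)]]
    by (intro integral_mono) (auto simp: norm_mult intro!: mult_left_mono)
  finally show ?thesis by simp
qed

lemma cavg_BUC:
  assumes w: "integrable M w" and Y: "Y \<in> borel_measurable M" and f: "f \<in> BUC"
  shows "cavg M w Y f \<in> BUC"
proof -
  obtain B where B: "\<And>x. norm (f x) \<le> B" using BUC_bound f by blast
  let ?L = "LINT s|M. norm (w s)"
  have L: "?L \<ge> 0" by simp
  show ?thesis
  proof (rule BUC_I)
    show "norm (cavg M w Y f x) \<le> ?L * B" for x
      by (rule cavg_norm_le[OF assms B])
    fix e :: real assume e: "e > 0"
    obtain d where d: "d > 0" "\<And>x y. dist x y < d \<Longrightarrow> norm (f x - f y) < e / (?L + 1)"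
      using BUC_uniform[OF f, of "e / (?L + 1)"] e L by auto
    have "norm (cavg M w Y f x - cavg M w Y f y) < e" if "dist x y < d" for x y
    proof -
      have "norm (cavg M w Y f x - cavg M w Y f y)
          = norm (LINT s|M. w s * f (x - Y s) - w s * f (y - Y s))"
        unfolding cavg_def using cavg_integrable[OF assms] by simp
      also have "\<dots> \<le> (LINT s|M. norm (w s * f (x - Y s) - w s * f (y - Y s)))"
        by (rule integral_norm_bound)
      also have "\<dots> \<le> (LINT s|M. norm (w s) * (e / (?L + 1)))"
      proof (rule integral_mono)
        fix s
        have "norm (f (x - Y s) - f (y - Y s)) \<le> e / (?L + 1)"
          using d(2)[of "x - Y s" "y - Y s"] that by (simp add: dist_norm)
        then show "norm (w s * f (x - Y s) - w s * f (y - Y s)) \<le> norm (w s) * (e / (?L + 1))"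
          by (metis norm_mult norm_ge_zero mult_left_mono right_diff_distrib)
      qed (use assms cavg_integrable[OF assms] in auto)
      also have "\<dots> = ?L * (e / (?L + 1))" by simp
      also have "\<dots> < e" using e L by (simp add: field_simps add_pos_nonneg)
      finally show ?thesis .
    qed
    with d show "\<exists>d>0. \<forall>x y. dist x y < d \<longrightarrow> norm (cavg M w Y f x - cavg M w Y f y) < e" by blast
  qed
qed

lemma (in pair_sigma_finite) integrable_prod_mult:
  fixes w v :: "_ \<Rightarrow> complex"
  assumes [measurable]: "integrable M1 w" "integrable M2 v"
  shows "integrable (M1 \<Otimes>\<^sub>M M2) (\<lambda>(s, u). w s * v u)"
  by (rule Fubini_integrable) (use assms in \<open>auto simp: norm_mult\<close>)

text \<open>Fubini, with the integrable majorant \<open>w s * v u * B\<close> for a bound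
  \<open>B\<close> of \<open>f\<close>. Commutation is what lets one convolution preserve the
  spectral localization expressed by another.\<close>

lemma cavg_commute:
  assumes "sigma_finite_measure M" "sigma_finite_measure N"
    and w [measurable]: "integrable M w" and Y [measurable]: "Y \<in> borel_measurable M"
    and v [measurable]: "integrable N v" and Z [measurable]: "Z \<in> borel_measurable N"
    and f: "f \<in> BUC"
  shows "cavg M w Y (cavg N v Z f) = cavg N v Z (cavg M w Y f)"
proof
  fix x
  interpret M: sigma_finite_measure M by fact
  interpret N: sigma_finite_measure N by fact
  interpret MN: pair_sigma_finite M N ..
  note [measurable] = BUC_measurable[OF f]
  obtain B where B: "\<And>x. norm (f x) \<le> B" using BUC_bound f by blast
  have "integrable (M \<Otimes>\<^sub>M N) (\<lambda>(s, u). w s * (v u * f (x - Y s - Z u)))"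
  proof (rule Bochner_Integration.integrable_bound)
    show "integrable (M \<Otimes>\<^sub>M N) (\<lambda>z. (case z of (s, u) \<Rightarrow> w s * v u) * of_real B)"
      using MN.integrable_prod_mult[OF w v] by simp
    have *: "norm (w s * (v u * f (x - Y s - Z u))) \<le> norm (w s * v u * of_real B)" for s u
      using order_trans[OF B[of "x - Y s - Z u"] abs_ge_self]
      by (auto simp: norm_mult mult.assoc intro!: mult_left_mono)
    show "AE z in M \<Otimes>\<^sub>M N. norm (case z of (s, u) \<Rightarrow> w s * (v u * f (x - Y s - Z u)))
        \<le> norm ((case z of (s, u) \<Rightarrow> w s * v u) * of_real B)"
      using * by (intro AE_I2) (auto split: prod.splits)
  qed measurable
  from MN.Fubini_integral[OF this]
  have "(LINT u|N. LINT s|M. v u * (w s * f (x - Z u - Y s)))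
      = (LINT s|M. LINT u|N. w s * (v u * f (x - Y s - Z u)))"
    by (simp only: mult.left_commute[of "v _"] cancel_ab_semigroup_add_class.diff_right_commute[of x "Z _"])
  then show "cavg M w Y (cavg N v Z f) x = cavg N v Z (cavg M w Y f) x"
    by (simp add: cavg_def)
qed

text \<open>Composing convolutions in the same direction convolves the kernels. The kernel identity
  is asked for only almost everywhere, because for the Fejer kernel it is available only for
  \<open>r\<close> other than \<open>0\<close>.\<close>

lemma cavg_reproducing:
  fixes b :: "'a::euclidean_space" and v w :: "real \<Rightarrow> complex"
  assumes v [measurable]: "integrable lborel v" and w [measurable]: "integrable lborel w"
    and f: "f \<in> BUC"
    and vw: "AE r in lborel. (LINT u|lborel. v u * w (r - u)) = w r"
  shows "cavg lborel v (\<lambda>s. s *\<^sub>R b) (cavg lborel w (\<lambda>s. s *\<^sub>R b) f) = cavg lborel w (\<lambda>s. s *\<^sub>R b) f"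
proof
  fix x
  note [measurable] = BUC_measurable[OF f]
  obtain B where B: "\<And>x. norm (f x) \<le> B" using BUC_bound f by blast
  have w': "integrable lborel (\<lambda>r. w (r - u))" for u
    using lborel_integrable_real_affine[OF w, of 1 "-u"] by simp
  have wn: "(LINT r|lborel. norm (w (r - u))) = (LINT r|lborel. norm (w r))" for u
    using lborel_integral_real_affine[of 1 "\<lambda>r. norm (w r)" "-u"] by simp
  have vw_int: "integrable (lborel \<Otimes>\<^sub>M lborel) (\<lambda>(u, r). v u * w (r - u))"
    by (rule lborel_pair.Fubini_integrable) (use v w' wn in \<open>auto simp: norm_mult\<close>)
  have "integrable (lborel \<Otimes>\<^sub>M lborel) (\<lambda>(u, r). v u * (w (r - u) * f (x - r *\<^sub>R b)))"
  proof (rule Bochner_Integration.integrable_bound)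
    show "integrable (lborel \<Otimes>\<^sub>M lborel) (\<lambda>z. (case z of (u, r) \<Rightarrow> v u * w (r - u)) * of_real B)"
      using vw_int by simp
    have *: "norm (v u * (w (r - u) * f (x - r *\<^sub>R b))) \<le> norm (v u * w (r - u) * of_real B)" for u r
      using order_trans[OF B[of "x - r *\<^sub>R b"] abs_ge_self]
      by (auto simp: norm_mult mult.assoc intro!: mult_left_mono)
    show "AE z in lborel \<Otimes>\<^sub>M lborel. norm (case z of (u, r) \<Rightarrow> v u * (w (r - u) * f (x - r *\<^sub>R b)))
        \<le> norm ((case z of (u, r) \<Rightarrow> v u * w (r - u)) * of_real B)"
      using * by (intro AE_I2) (auto split: prod.splits)
  qed measurable
  note fub = lborel_pair.Fubini_integral[OF this]
  have "cavg lborel v (\<lambda>s. s *\<^sub>R b) (cavg lborel w (\<lambda>s. s *\<^sub>R b) f) x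
      = (LINT u|lborel. LINT s|lborel. v u * (w s * f (x - u *\<^sub>R b - s *\<^sub>R b)))"
    by (simp add: cavg_def)
  \<comment> \<open>Substitution \<open>s = r - u\<close>, which makes the argument of
    \<open>f\<close> independent of \<open>u\<close>.\<close>
  also have "\<dots> = (LINT u|lborel. LINT r|lborel. v u * (w (r - u) * f (x - r *\<^sub>R b)))"
  proof (rule Bochner_Integration.integral_cong[OF refl])
    fix u
    show "(LINT s|lborel. v u * (w s * f (x - u *\<^sub>R b - s *\<^sub>R b)))
        = (LINT r|lborel. v u * (w (r - u) * f (x - r *\<^sub>R b)))"
      by (subst lborel_integral_real_affine[of 1 _ "-u"]) (auto simp: algebra_simps)
  qed
  also have "\<dots> = (LINT r|lborel. LINT u|lborel. v u * (w (r - u) * f (x - r *\<^sub>R b)))"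
    using fub by simp
  also have "\<dots> = (LINT r|lborel. (LINT u|lborel. v u * w (r - u)) * f (x - r *\<^sub>R b))"
    by (simp add: mult.assoc[symmetric])
  also have "\<dots> = (LINT r|lborel. w r * f (x - r *\<^sub>R b))"
    using vw by (intro integral_cong_AE) (auto elim!: eventually_mono)
  finally show "cavg lborel v (\<lambda>s. s *\<^sub>R b) (cavg lborel w (\<lambda>s. s *\<^sub>R b) f) x
      = cavg lborel w (\<lambda>s. s *\<^sub>R b) f x" by (simp add: cavg_def)
qed

section \<open>Fejer and de la Vallee Poussin kernels\<close>

text \<open>Up to the factor \<open>1 / (pi * a)\<close> this is the Fejer kernel with spectrum \<open>{-a..a}\<close>. Its value at
  \<open>s = 0\<close> is \<open>0\<close> by the division convention, not the limit \<open>a\<^sup>2 / 2\<close>, so some identities exclude that point.\<close>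

definition fker :: "real \<Rightarrow> real \<Rightarrow> real" where
  "fker a s = (1 - cos (a * s)) / s\<^sup>2"

lemma fker_measurable [measurable]: "fker a \<in> borel_measurable borel"
  unfolding fker_def by measurable

lemma fker_nonneg: "0 \<le> fker a s"
  by (simp add: fker_def)

lemma fker_minus: "fker a (- s) = fker a s"
  by (simp add: fker_def)

lemma one_minus_cos_le: "1 - cos x \<le> x\<^sup>2 / 2" for x :: real
proof -
  have "1 - cos x = 2 * (sin (x / 2))\<^sup>2" using cos_double_sin[of "x / 2"] by simp
  also have "\<dots> \<le> 2 * (x / 2)\<^sup>2"
    using abs_sin_x_le_abs_x[of "x / 2"] by (intro mult_left_mono) (auto simp: abs_le_square_iff[symmetric])
  finally show ?thesis by (simp add: power2_eq_square)
qed

lemma fker_le: "fker a s \<le> 2 / s\<^sup>2"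
  unfolding fker_def using cos_ge_minus_one[of "a * s"] by (intro divide_right_mono) auto

text \<open>Adds the bound \<open>a\<^sup>2 / 2\<close>, good near \<open>0\<close>, to the bound
  \<open>2\<close> for \<open>fker a s * s\<^sup>2\<close>, good at infinity.\<close>

lemma fker_bound: "fker a s \<le> (a\<^sup>2 / 2 + 2) / (1 + s\<^sup>2)"
proof (cases "s = 0")
  case False
  have "fker a s \<le> ((a * s)\<^sup>2 / 2) / s\<^sup>2"
    unfolding fker_def by (intro divide_right_mono one_minus_cos_le) auto
  then have "fker a s \<le> a\<^sup>2 / 2" using False by (simp add: power_mult_distrib)
  moreover have "fker a s * s\<^sup>2 \<le> 2"
    using False cos_ge_minus_one[of "a * s"] by (simp add: fker_def)
  ultimately show ?thesis
    by (simp add: pos_le_divide_eq add_pos_nonneg distrib_left)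
qed (simp add: fker_def)

lemma inverse_1_plus_square_integrable: "integrable lborel (\<lambda>x::real. 1 / (1 + x\<^sup>2))"
  using integrable_inverse_1_plus_square
  by (simp add: set_integrable_def einterval_def inverse_eq_divide)

lemma fker_integrable: "integrable lborel (fker a)"
proof (rule Bochner_Integration.integrable_bound)
  show "integrable lborel (\<lambda>s. (a\<^sup>2 / 2 + 2) * (1 / (1 + s\<^sup>2)))"
    using inverse_1_plus_square_integrable by (rule integrable_mult_right)
  show "AE s in lborel. norm (fker a s) \<le> norm ((a\<^sup>2 / 2 + 2) * (1 / (1 + s\<^sup>2)))"
    using fker_bound[of a] by (auto simp: fker_nonneg)
qed simp

text \<open>Integration by parts gives the antiderivative \<open>F\<close> in terms of the sine
  integral, with limits \<open>0\<close> at \<open>0\<close> and \<open>pi / 2\<close> at infinity;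
  evenness doubles the half-line integral.\<close>

lemma fker_1_integral: "(LINT s|lborel. fker 1 s) = pi"
proof -
  define F where "F x = Si x - (1 - cos x) / x" for x
  have F0: "(F \<longlongrightarrow> 0) (at_right 0)"
  proof -
    have "((\<lambda>x::real. (1 - cos x) / x) \<longlongrightarrow> 0) (at_right 0)"
    proof (rule tendsto_sandwich[of "\<lambda>_. 0" _ _ "\<lambda>x. x / 2"])
      show "\<forall>\<^sub>F x::real in at_right 0. 0 \<le> (1 - cos x) / x"
        using eventually_at_right_less[of "0::real"] by eventually_elim simp
      show "\<forall>\<^sub>F x::real in at_right 0. (1 - cos x) / x \<le> x / 2"
        using eventually_at_right_less[of "0::real"]
      proof eventually_elim
        case (elim x)
        then show ?case using one_minus_cos_le[of x]
          by (simp add: pos_divide_le_eq power2_eq_square)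
      qed
    qed (auto intro!: tendsto_eq_intros)
    moreover have "(Si \<longlongrightarrow> Si 0) (at_right 0)"
      using isCont_Si[of 0] by (simp add: continuous_within filterlim_at_split)
    moreover have "Si 0 = 0" using Si_neg[of 0] by simp
    ultimately show ?thesis
      using tendsto_diff[of Si 0 "at_right 0" "\<lambda>x. (1 - cos x) / x" 0] by (simp add: F_def[abs_def])
  qed
  have F1: "(F \<longlongrightarrow> pi / 2) at_top"
  proof -
    have "((\<lambda>x::real. (1 - cos x) / x) \<longlongrightarrow> 0) at_top"
    proof (rule tendsto_sandwich[of "\<lambda>_. 0" _ _ "\<lambda>x. 2 / x"])
      show "\<forall>\<^sub>F x::real in at_top. 0 \<le> (1 - cos x) / x"
        using eventually_gt_at_top[of "0::real"] by eventually_elim simp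
      show "\<forall>\<^sub>F x::real in at_top. (1 - cos x) / x \<le> 2 / x"
        using eventually_gt_at_top[of "0::real"]
      proof eventually_elim
        case (elim x)
        then show ?case using cos_ge_minus_one[of x] by (intro divide_right_mono) auto
      qed
    qed (auto intro!: real_tendsto_divide_at_top[OF tendsto_const filterlim_ident])
    with Si_at_top show ?thesis
      using tendsto_diff[of Si "pi / 2" at_top "\<lambda>x. (1 - cos x) / x" 0] by (simp add: F_def[abs_def])
  qed
  have D: "(F has_real_derivative fker 1 x) (at x)" if "0 < x" for x
    unfolding F_def using that
    by (auto intro!: derivative_eq_intros DERIV_Si simp: fker_def field_simps power2_eq_square)
  have C: "isCont (fker 1) x" if "0 < x" for x
    using that unfolding fker_def by (intro continuous_intros) auto
  note FTC = interval_integral_FTC_nonneg[of 0 \<infinity> F "fker 1" 0 "pi / 2"]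
  have "set_integrable lborel (einterval 0 \<infinity>) (fker 1)" "(LBINT x=0..\<infinity>. fker 1 x) = pi / 2"
    using F0 F1 D C FTC
    by (auto simp: zero_ereal_def ereal_tendsto_simps fker_nonneg)
  then have "has_bochner_integral lborel (\<lambda>x. indicator {0<..} x *\<^sub>R fker 1 x) (pi / 2)"
    by (simp add: interval_lebesgue_integral_0_infty has_bochner_integral_iff set_integrable_def
        set_lebesgue_integral_def einterval_def greaterThan_def)
  \<comment> \<open>The symmetry rule wants the closed half-line; adding the point \<open>0\<close>
    changes nothing since \<open>fker 1 0 = 0\<close>.\<close>
  then have "has_bochner_integral lborel (\<lambda>x. indicator {0..} x *\<^sub>R fker 1 x) (pi / 2)"
    by (rule has_bochner_integral_cong[THEN iffD1, rotated -1])
      (auto split: split_indicator simp: fker_def order_le_less)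
  from has_bochner_integral_even_function[OF this fker_minus]
  show ?thesis by (simp add: has_bochner_integral_iff)
qed

lemma fker_integral: "(LINT s|lborel. fker a s) = pi * \<bar>a\<bar>"
proof (cases "a = 0")
  case False
  have "pi = \<bar>a\<bar> * (LINT s|lborel. fker 1 (a * s))"
    using lborel_integral_real_affine[OF False, of "fker 1" 0] fker_1_integral by simp
  also have "(\<lambda>s. fker 1 (a * s)) = (\<lambda>s. fker a s / a\<^sup>2)"
    using False by (auto simp: fker_def fun_eq_iff power_mult_distrib)
  finally have "pi = \<bar>a\<bar> * ((LINT s|lborel. fker a s) / (\<bar>a\<bar> * \<bar>a\<bar>))"
    by (simp add: power2_eq_square)
  with False have "pi * \<bar>a\<bar> * \<bar>a\<bar> = (LINT s|lborel. fker a s) * \<bar>a\<bar>"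
    by (simp add: field_simps abs_mult[symmetric])
  then show ?thesis using False by simp
qed (simp add: fker_def)

text \<open>The product formula for cosines reduces the integrand to three kernels without
  modulation. The right-hand side is the tent
  \<open>pi * max (\<bar>a\<bar> - \<bar>t\<bar>) 0\<close>.\<close>

lemma fker_cos_integral:
  "(LINT s|lborel. fker a s * cos (t * s)) = pi * ((\<bar>a + t\<bar> + \<bar>a - t\<bar>) / 2 - \<bar>t\<bar>)"
proof -
  have "fker a s * cos (t * s) = (fker (a + t) s + fker (a - t) s) / 2 - fker t s" for s
    by (simp add: fker_def distrib_right left_diff_distrib cos_add cos_diff add_divide_distrib
        diff_divide_distrib flip: times_divide_eq_left)
      (simp add: field_simps)
  then have "(LINT s|lborel. fker a s * cos (t * s))
      = (LINT s|lborel. (fker (a + t) s + fker (a - t) s) / 2 - fker t s)" by simp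
  also have "\<dots> = ((LINT s|lborel. fker (a + t) s) + (LINT s|lborel. fker (a - t) s)) / 2
      - (LINT s|lborel. fker t s)"
    by (simp add: fker_integrable)
  finally show ?thesis by (simp add: fker_integral algebra_simps)
qed

text \<open>Fourier inversion of the tent, done by hand with the antiderivative
  \<open>(a - t) * sin (t * x) / x - cos (t * x) / x\<^sup>2\<close>. At \<open>x = 0\<close> the
  integral would be \<open>a\<^sup>2 / 2\<close>, unlike \<open>fker a 0\<close>.\<close>

lemma fker_eq_cos_transform:
  assumes "0 < a" "x \<noteq> 0"
  shows "(LINT t|lborel. (indicator {0..a} t * (a - t)) * cos (t * x)) = fker a x"
proof -
  have "(LBINT t. indicator {0..a} t *\<^sub>R ((a - t) * cos (t * x)))
      = ((a - a) * sin (a * x) / x - cos (a * x) / x\<^sup>2) - ((a - 0) * sin (0 * x) / x - cos (0 * x) / x\<^sup>2)"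
    using assms
    by (intro integral_FTC_Icc)
      (auto intro!: derivative_eq_intros continuous_intros
        simp: has_real_derivative_iff_has_vector_derivative[symmetric] field_simps power2_eq_square)
  then show ?thesis by (simp add: fker_def diff_divide_distrib mult.assoc)
qed

text \<open>The de la Vallee Poussin kernel: twice the Fejer kernel of order \<open>2 a\<close> minus the one of order \<open>a\<close>,
  so that its Fourier transform is \<open>1\<close> on \<open>{-a..a}\<close>.\<close>

definition vker :: "real \<Rightarrow> real \<Rightarrow> real" where
  "vker a s = (fker (2 * a) s - fker a s) / (pi * a)"

lemma vker_measurable [measurable]: "vker a \<in> borel_measurable borel"
  unfolding vker_def by measurable

lemma vker_integrable: "integrable lborel (vker a)"
  unfolding vker_def using fker_integrable by simp

lemma vker_cos_integrable:
  assumes [measurable]: "f \<in> borel_measurable borel" and "\<And>s. \<bar>f s\<bar> \<le> 1"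
  shows "integrable lborel (\<lambda>s. vker a s * f s)"
  by (rule Bochner_Integration.integrable_bound[OF vker_integrable[of a]])
    (use assms(2) in \<open>auto simp: abs_mult intro!: mult_left_le\<close>)

text \<open>For these \<open>t\<close> the tents of orders \<open>2 * a\<close> and \<open>a\<close>
  differ by the constant \<open>pi * a\<close>, the normalizing factor of
  \<open>vker\<close>.\<close>

lemma vker_cos_integral:
  assumes "0 < a" "\<bar>t\<bar> \<le> a"
  shows "(LINT s|lborel. vker a s * cos (t * s)) = 1"
proof -
  have I: "integrable lborel (\<lambda>s. fker b s * cos (t * s))" for b
    by (rule Bochner_Integration.integrable_bound[OF fker_integrable[of b]])
      (auto simp: abs_mult intro!: mult_left_le)
  have "vker a s * cos (t * s) = (fker (2 * a) s * cos (t * s) - fker a s * cos (t * s)) / (pi * a)" for s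
    by (simp add: vker_def left_diff_distrib)
  then have "(LINT s|lborel. vker a s * cos (t * s))
    = ((LINT s|lborel. fker (2 * a) s * cos (t * s)) - (LINT s|lborel. fker a s * cos (t * s))) / (pi * a)"
    using I by simp
  also have "\<dots> = 1"
    unfolding fker_cos_integral using assms by (simp add: field_simps abs_if split: if_splits)
  finally show ?thesis .
qed

lemma vker_sin_integral: "(LINT s|lborel. vker a s * sin (t * s)) = 0"
proof -
  have "(LINT s|lborel. vker a s * sin (t * s)) = (LINT s|lborel. vker a (- s) * sin (t * - s))"
    using lborel_integral_real_affine[of "-1" "\<lambda>s. vker a s * sin (t * s)" 0] by simp
  also have "\<dots> = - (LINT s|lborel. vker a s * sin (t * s))"
    by (simp add: vker_def fker_minus)
  finally show ?thesis by simp
qed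

text \<open>The Fejer kernel is a superposition of cosines with frequencies in
  \<open>{0..a}\<close>, and convolution with \<open>vker a\<close> reproduces each of them because
  its Fourier transform is \<open>1\<close> there.\<close>

lemma vker_fker_convolution:
  assumes a: "0 < a" and x: "x \<noteq> 0"
  shows "(LINT y|lborel. vker a y * fker a (x - y)) = fker a x"
proof -
  let ?I = "\<lambda>t. indicator {0..a} t * (a - t) :: real"
  have I: "integrable lborel ?I"
    using borel_integrable_atLeastAtMost'[OF continuous_on_op_minus, of 0 a a]
    by (simp add: set_integrable_def)
  have vI: "integrable (lborel \<Otimes>\<^sub>M lborel) (\<lambda>(y, t). vker a y * ?I t)"
    by (rule lborel_pair.Fubini_integrable)
      (use vker_integrable[of a] I in \<open>auto simp: abs_mult\<close>)
  have "integrable (lborel \<Otimes>\<^sub>M lborel) (\<lambda>(y, t). vker a y * (?I t * cos (t * (x - y))))"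
  proof (rule Bochner_Integration.integrable_bound[OF vI])
    have "norm (vker a y * (?I t * cos (t * (x - y)))) \<le> norm (vker a y * ?I t)" for y t
      using mult_left_le[OF abs_cos_le_one[of "t * (x - y)"], of "\<bar>vker a y * ?I t\<bar>"]
      by (simp add: abs_mult mult.assoc)
    then show "AE z in lborel \<Otimes>\<^sub>M lborel. norm (case z of (y, t) \<Rightarrow> vker a y * (?I t * cos (t * (x - y))))
        \<le> norm (case z of (y, t) \<Rightarrow> vker a y * ?I t)"
      by (intro AE_I2) (auto split: prod.splits)
  qed measurable
  note fub = lborel_pair.Fubini_integral[OF this]
  have "(LINT y|lborel. vker a y * fker a (x - y))
      = (LINT y|lborel. LINT t|lborel. vker a y * (?I t * cos (t * (x - y))))"
  proof (rule integral_cong_AE)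
    show "AE y in lborel. vker a y * fker a (x - y) = (LINT t|lborel. vker a y * (?I t * cos (t * (x - y))))"
      \<comment> \<open>The transform formula fails where \<open>x - y = 0\<close>, which is a null
        set of \<open>y\<close>.\<close>
      using AE_lborel_singleton[of x]
    proof eventually_elim
      case (elim y)
      then show ?case using fker_eq_cos_transform[OF a, of "x - y"] by simp
    qed
  qed measurable
  also have "\<dots> = (LINT t|lborel. LINT y|lborel. vker a y * (?I t * cos (t * (x - y))))"
    using fub by simp
  also have "\<dots> = (LINT t|lborel. ?I t * cos (t * x))"
  proof (rule Bochner_Integration.integral_cong[OF refl])
    fix t
    \<comment> \<open>The addition formula separates \<open>x\<close> from \<open>y\<close>; the
      sine part integrates to \<open>0\<close> because \<open>vker a\<close> is even.\<close>
    have "(LINT y|lborel. vker a y * (?I t * cos (t * (x - y))))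
        = (LINT y|lborel. ?I t * cos (t * x) * (vker a y * cos (t * y)) + ?I t * sin (t * x) * (vker a y * sin (t * y)))"
      by (simp add: right_diff_distrib cos_diff algebra_simps)
    also have "\<dots> = ?I t * cos (t * x) * (LINT y|lborel. vker a y * cos (t * y))
        + ?I t * sin (t * x) * (LINT y|lborel. vker a y * sin (t * y))"
      using vker_cos_integrable[of "\<lambda>y. cos (t * y)" a] vker_cos_integrable[of "\<lambda>y. sin (t * y)" a]
      by simp
    also have "\<dots> = ?I t * cos (t * x)"
      using vker_cos_integral[OF a, of t] by (auto simp: vker_sin_integral split: split_indicator)
    finally show "(LINT y|lborel. vker a y * (?I t * cos (t * (x - y)))) = ?I t * cos (t * x)" .
  qed
  also have "\<dots> = fker a x" using fker_eq_cos_transform[OF a x] by simp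
  finally show ?thesis .
qed

section \<open>The modulus of continuity of the de la Vallee Poussin kernel in the L1 norm\<close>

definition vmod :: "real \<Rightarrow> real" where
  "vmod r = (LINT u|lborel. \<bar>vker 1 (u - r) - vker 1 u\<bar>)"

lemma vker_shift_integrable: "integrable lborel (\<lambda>u. vker a (u - r))"
  using lborel_integrable_real_affine[OF vker_integrable, of 1 a "-r"] by simp

lemma vmod_measurable [measurable]: "vmod \<in> borel_measurable borel"
  unfolding vmod_def by measurable

lemma vmod_nonneg: "0 \<le> vmod r"
  by (simp add: vmod_def)

lemma vmod_le: "vmod r \<le> 2 * (LINT u|lborel. \<bar>vker 1 u\<bar>)"
proof -
  have "vmod r \<le> (LINT u|lborel. \<bar>vker 1 (u - r)\<bar> + \<bar>vker 1 u\<bar>)"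
    unfolding vmod_def
    using vker_shift_integrable[of 1 r] vker_integrable[of 1] by (intro integral_mono) auto
  also have "\<dots> = (LINT u|lborel. \<bar>vker 1 (u - r)\<bar>) + (LINT u|lborel. \<bar>vker 1 u\<bar>)"
    using vker_shift_integrable[of 1 r] vker_integrable[of 1] by simp
  also have "(LINT u|lborel. \<bar>vker 1 (u - r)\<bar>) = (LINT u|lborel. \<bar>vker 1 u\<bar>)"
    using lborel_integral_real_affine[of 1 "\<lambda>u. \<bar>vker 1 u\<bar>" "-r"] by simp
  finally show ?thesis by simp
qed

text \<open>From \<open>vker a s = a * vker 1 (a * s)\<close>: a shift by \<open>h\<close> at order
  \<open>a\<close> costs as much as a shift by \<open>a * h\<close> at order \<open>1\<close>. Hence
  narrow spectrum makes shifts cheap.\<close>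

lemma vmod_scale:
  assumes "0 < a"
  shows "(LINT s|lborel. \<bar>vker a (s - h) - vker a s\<bar>) = vmod (a * h)"
proof -
  have v: "vker a s = a * vker 1 (a * s)" for s
  proof -
    have "fker b (a * s) = fker (b * a) s / a\<^sup>2" for b
      using assms by (simp add: fker_def power_mult_distrib mult.assoc)
    then show ?thesis using assms
      by (simp add: vker_def diff_divide_distrib[symmetric] power2_eq_square)
  qed
  have "vmod (a * h) = a * (LINT s|lborel. \<bar>vker 1 (a * s - a * h) - vker 1 (a * s)\<bar>)"
    unfolding vmod_def
    using lborel_integral_real_affine[of a "\<lambda>u. \<bar>vker 1 (u - a * h) - vker 1 u\<bar>" 0] assms by simp
  also have "\<dots> = (LINT s|lborel. a * \<bar>vker 1 (a * s - a * h) - vker 1 (a * s)\<bar>)"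
    by simp
  also have "\<dots> = (LINT s|lborel. \<bar>vker a (s - h) - vker a s\<bar>)"
    using assms unfolding v by (simp add: right_diff_distrib[symmetric] abs_mult)
  finally show ?thesis by simp
qed

text \<open>Dominated convergence: \<open>vker 1\<close> is continuous away from \<open>0\<close>,
  and its quadratic decay gives a majorant uniform over shifts bounded by \<open>R\<close>.\<close>

lemma vmod_tendsto_0:
  assumes r: "r \<longlonglongrightarrow> 0"
  shows "(\<lambda>n. vmod (r n)) \<longlonglongrightarrow> 0"
proof -
  from r have "Bseq r" by (intro convergent_imp_Bseq convergentI)
  then obtain R where R: "\<And>n. \<bar>r n\<bar> \<le> R" unfolding Bseq_def by auto
  \<comment> \<open>The constant \<open>a\<^sup>2 / 2 + 2\<close> of \<open>fker_bound\<close> is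
    \<open>4\<close> for \<open>a = 2\<close> and \<open>5 / 2\<close> for
    \<open>a = 1\<close>.\<close>
  define C where "C = (4::real)"
  have C: "\<bar>vker 1 s\<bar> \<le> C / (1 + s\<^sup>2)" for s
  proof -
    have "\<bar>vker 1 s\<bar> \<le> \<bar>fker 2 s - fker 1 s\<bar>"
      unfolding vker_def using pi_gt3 by (simp add: abs_divide divide_le_eq mult_le_cancel_left1)
    moreover have "fker 2 s \<le> C / (1 + s\<^sup>2)" using fker_bound[of 2 s] by (simp add: C_def)
    moreover have "fker 1 s \<le> C / (1 + s\<^sup>2)"
      using fker_bound[of 1 s] divide_right_mono[of "1 / 2 + 2" C "1 + s\<^sup>2"]
      by (simp add: C_def)
    ultimately show ?thesis using fker_nonneg[of 2 s] fker_nonneg[of 1 s] by linarith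
  qed
  \<comment> \<open>Chosen so that \<open>1 + u\<^sup>2 \<le> K * (1 + (u - r n)\<^sup>2)\<close>
    for every shift with \<open>\<bar>r n\<bar> \<le> R\<close>.\<close>
  define K where "K = 2 + 2 * R\<^sup>2"
  have "(\<lambda>n. LINT u|lborel. \<bar>vker 1 (u - r n) - vker 1 u\<bar>) \<longlonglongrightarrow> (LINT u|(lborel :: real measure). (0::real))"
  proof (rule integral_dominated_convergence[where M = lborel and f = "\<lambda>_. 0"
        and s = "\<lambda>n u. \<bar>vker 1 (u - r n) - vker 1 u\<bar>" and w = "\<lambda>u. (C * K + C) * (1 / (1 + u\<^sup>2))"])
    show "integrable lborel (\<lambda>u. (C * K + C) * (1 / (1 + u\<^sup>2)))"
      using inverse_1_plus_square_integrable by (rule integrable_mult_right)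
    show "AE u in lborel. (\<lambda>n. \<bar>vker 1 (u - r n) - vker 1 u\<bar>) \<longlonglongrightarrow> 0"
      using AE_lborel_singleton[of 0]
    proof eventually_elim
      case (elim u)
      then have "isCont (vker 1) u"
        unfolding vker_def fker_def by (intro continuous_intros) auto
      moreover have "(\<lambda>n. u - r n) \<longlonglongrightarrow> u" using r by (auto intro!: tendsto_eq_intros)
      ultimately have "(\<lambda>n. vker 1 (u - r n)) \<longlonglongrightarrow> vker 1 u"
        by (rule isCont_tendsto_compose)
      then show ?case
        using tendsto_rabs_zero LIM_zero by blast
    qed
    fix n
    have "norm \<bar>vker 1 (u - r n) - vker 1 u\<bar> \<le> (C * K + C) * (1 / (1 + u\<^sup>2))" for u
    proof -
      have R2: "(r n)\<^sup>2 \<le> R\<^sup>2" using R[of n] by (simp add: abs_le_square_iff[symmetric])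
      have "(u - 2 * r n)\<^sup>2 \<ge> 0" by simp
      then have "u\<^sup>2 \<le> 2 * (u - r n)\<^sup>2 + 2 * (r n)\<^sup>2"
        by (simp add: power2_eq_square algebra_simps)
      moreover have "0 \<le> R\<^sup>2 * (u - r n)\<^sup>2" by simp
      moreover have "K * (1 + (u - r n)\<^sup>2) = 2 + 2 * (u - r n)\<^sup>2 + 2 * R\<^sup>2 + 2 * (R\<^sup>2 * (u - r n)\<^sup>2)"
        by (simp add: K_def distrib_left distrib_right)
      ultimately have "1 + u\<^sup>2 \<le> K * (1 + (u - r n)\<^sup>2)"
        using R2 by linarith
      then have "1 / (1 + (u - r n)\<^sup>2) \<le> K / (1 + u\<^sup>2)"
        by (simp add: divide_le_eq pos_le_divide_eq add_pos_nonneg field_simps)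
      then have "C / (1 + (u - r n)\<^sup>2) \<le> C * K / (1 + u\<^sup>2)"
        using mult_left_mono[of "1 / (1 + (u - r n)\<^sup>2)" "K / (1 + u\<^sup>2)" C] by (simp add: C_def)
      with C[of "u - r n"] C[of u]
      have "\<bar>vker 1 (u - r n)\<bar> + \<bar>vker 1 u\<bar> \<le> C * K / (1 + u\<^sup>2) + C / (1 + u\<^sup>2)" by linarith
      then show ?thesis
        by (simp add: add_divide_distrib[symmetric])
    qed
    then show "AE u in lborel. norm \<bar>vker 1 (u - r n) - vker 1 u\<bar> \<le> (C * K + C) * (1 / (1 + u\<^sup>2))"
      by simp
  qed auto
  then show ?thesis by (simp add: vmod_def)
qed

section \<open>Functions with localized spectrum\<close>

text \<open>The Fejer kernel moved to frequency \<open>t\<close>, with spectrum within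
  \<open>a\<close> of \<open>t\<close>. The factor \<open>1 / (pi * a)\<close> gives it integral
  \<open>1\<close> when \<open>t = 0\<close> and \<open>a\<close> is positive.\<close>

definition Wker :: "real \<Rightarrow> real \<Rightarrow> real \<Rightarrow> complex" where
  "Wker a t s = of_real (fker a s / (pi * a)) * cis (t * s)"

definition Vker :: "real \<Rightarrow> real \<Rightarrow> real \<Rightarrow> complex" where
  "Vker a t s = of_real (vker a s) * cis (t * s)"

lemma cis_measurable [measurable]: "cis \<in> borel_measurable borel"
  by (intro borel_measurable_continuous_onI continuous_intros)

lemma Wker_integrable: "integrable lborel (Wker a t)"
  unfolding Wker_def
  by (rule Bochner_Integration.integrable_bound[OF integrable_divide[OF fker_integrable[of a], of "pi * a"]])
    (auto simp: norm_mult norm_divide abs_mult)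

lemma Vker_integrable: "integrable lborel (Vker a t)"
  unfolding Vker_def
  by (rule Bochner_Integration.integrable_bound[OF vker_integrable[of a]]) (auto simp: norm_mult)

text \<open>The modulations multiply to \<open>cis (t * r)\<close>, which does not depend on
  \<open>u\<close>, so the identity reduces to the one for \<open>t = 0\<close>.\<close>

lemma Vker_Wker_convolution:
  assumes "0 < a" "r \<noteq> 0"
  shows "(LINT u|lborel. Vker a t u * Wker a t (r - u)) = Wker a t r"
proof -
  have "Vker a t u * Wker a t (r - u)
      = of_real (vker a u * fker a (r - u)) * (cis (t * r) / of_real (pi * a))" for u
    by (simp add: Vker_def Wker_def right_diff_distrib cis_divide[symmetric])
  then have "(LINT u|lborel. Vker a t u * Wker a t (r - u))
      = of_real (LINT u|lborel. vker a u * fker a (r - u)) * (cis (t * r) / of_real (pi * a))"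
    by (simp only: integral_mult_left_zero integral_complex_of_real)
  then show ?thesis by (simp add: vker_fker_convolution[OF assms] Wker_def)
qed

abbreviation dconv :: "(real \<Rightarrow> complex) \<Rightarrow> 'a::euclidean_space \<Rightarrow> ('a \<Rightarrow> complex) \<Rightarrow> 'a \<Rightarrow> complex" where
  "dconv w b \<equiv> cavg lborel w (\<lambda>s. s *\<^sub>R b)"

lemma sigma_finite_lborel_real: "sigma_finite_measure (lborel :: real measure)"
  by unfold_locales

lemma dconv_Vker_Wker:
  assumes "0 < a" "f \<in> BUC"
  shows "dconv (Vker a t) b (dconv (Wker a t) b f) = dconv (Wker a t) b f"
  by (rule cavg_reproducing[OF Vker_integrable Wker_integrable assms(2)])
    (use AE_lborel_singleton[of 0] in eventually_elim, simp add: Vker_Wker_convolution assms(1))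

text \<open>Reproduction by the kernels \<open>Vker\<close> stands in for the condition that the spectrum of \<open>g\<close> is
  within \<open>a\<close> of \<open>t b\<close> in each coordinate \<open>b \<in> S\<close>.\<close>

definition localized :: "'a::euclidean_space set \<Rightarrow> real \<Rightarrow> ('a \<Rightarrow> real) \<Rightarrow> ('a \<Rightarrow> complex) \<Rightarrow> bool" where
  "localized S a t g \<longleftrightarrow> g \<in> BUC \<and> (\<forall>b\<in>S. dconv (Vker a (t b)) b g = g)"

lemma localized_BUC: "localized S a t g \<Longrightarrow> g \<in> BUC"
  by (simp add: localized_def)

text \<open>Convolutions commute, so applying another one respects every reproduction
  identity.\<close>

lemma localized_cavg:
  assumes "sigma_finite_measure M" "integrable M w" "Y \<in> borel_measurable M" "localized S a t g"
  shows "localized S a t (cavg M w Y g)"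
  using assms cavg_commute[OF sigma_finite_lborel_real assms(1) Vker_integrable _ assms(2,3), of "\<lambda>s. s *\<^sub>R b" g for b]
  by (auto simp: localized_def cavg_BUC)

lemma localized_diff_cmult:
  assumes f: "localized S a t f" and g: "localized S a t g"
  shows "localized S a t (\<lambda>x. f x - c * g x)"
proof -
  have "dconv (Vker a (t b)) b (\<lambda>x. f x - c * g x) x = f x - c * g x" if "b \<in> S" for b x
    using that f g cavg_diff[OF Vker_integrable _ localized_BUC[OF f] BUC_cmult[OF localized_BUC[OF g]], of "\<lambda>s. s *\<^sub>R b" a "t b" c x]
    by (simp add: cavg_cmult localized_def)
  then show ?thesis using f g by (auto simp: localized_def BUC_diff BUC_cmult)
qed

text \<open>\<open>Vker a k\<close> reproduces \<open>Wker a k\<close>, which gives the new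
  coordinate; the old ones survive by commutation, and \<open>b \<notin> S\<close> keeps their
  frequencies untouched by the update of \<open>t\<close>.\<close>

lemma localized_insert:
  assumes "0 < a" "localized S a t g" "b \<notin> S"
  shows "localized (insert b S) a (t(b := k)) (dconv (Wker a k) b g)"
proof -
  have "localized S a t (dconv (Wker a k) b g)"
    by (intro localized_cavg sigma_finite_lborel_real Wker_integrable assms) simp
  with assms show ?thesis
    by (auto simp: localized_def dconv_Vker_Wker)
qed

section \<open>Localized functions under translation\<close>

lemma localized_shift:
  assumes a: "0 < a" and g: "g \<in> BUC" and eq: "dconv (Vker a t) b g = g"
    and B: "\<And>x. norm (g x) \<le> B"
  shows "norm (g (x - h *\<^sub>R b) - cis (- (t * h)) * g x) \<le> vmod (a * h) * B"
proof -
  let ?V = "\<lambda>s. Vker a t s * g (x - s *\<^sub>R b)"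
  let ?U = "\<lambda>s. of_real (vker a (s - h)) * cis (t * s) * g (x - s *\<^sub>R b)"
  have V: "integrable lborel ?V"
    by (rule cavg_integrable[OF Vker_integrable _ g]) simp
  have "integrable lborel (\<lambda>s. complex_of_real (vker a (s - h)) * cis (t * s))"
    by (rule Bochner_Integration.integrable_bound[OF vker_shift_integrable[of a h]]) (auto simp: norm_mult)
  then have U: "integrable lborel ?U"
    by (rule cavg_integrable[OF _ _ g]) simp
  have "g (x - h *\<^sub>R b) = (LINT s|lborel. Vker a t s * g (x - h *\<^sub>R b - s *\<^sub>R b))"
    by (subst eq[symmetric]) (simp add: cavg_def)
  \<comment> \<open>The reproducing identity moves the translation from \<open>g\<close> to the
    kernel; pulling out the phase \<open>cis (- (t * h))\<close> then leaves only the translate of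
    \<open>vker a\<close> to compare with \<open>vker a\<close>.\<close>
  also have "\<dots> = (LINT s|lborel. Vker a t (s - h) * g (x - s *\<^sub>R b))"
    by (subst lborel_integral_real_affine[of 1 _ "-h"]) (auto simp: algebra_simps)
  also have "\<dots> = (LINT s|lborel. cis (- (t * h)) * ?U s)"
  proof -
    have "Vker a t (s - h) = cis (- (t * h)) * (of_real (vker a (s - h)) * cis (t * s))" for s
      by (simp add: Vker_def right_diff_distrib mult.left_commute[of "cis _"] cis_mult)
    then show ?thesis by (simp only: mult.assoc)
  qed
  finally have 1: "g (x - h *\<^sub>R b) = cis (- (t * h)) * (LINT s|lborel. ?U s)" by simp
  have 2: "g x = (LINT s|lborel. ?V s)"
    by (subst eq[symmetric]) (simp add: cavg_def)
  have "g (x - h *\<^sub>R b) - cis (- (t * h)) * g x = cis (- (t * h)) * (LINT s|lborel. ?U s - ?V s)"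
    unfolding 1 2 by (simp add: U V right_diff_distrib)
  then have "norm (g (x - h *\<^sub>R b) - cis (- (t * h)) * g x) \<le> (LINT s|lborel. norm (?U s - ?V s))"
    by (simp add: norm_mult integral_norm_bound)
  also have "\<dots> \<le> (LINT s|lborel. \<bar>vker a (s - h) - vker a s\<bar> * B)"
  proof (rule integral_mono)
    fix s
    have "?U s - ?V s = of_real (vker a (s - h) - vker a s) * cis (t * s) * g (x - s *\<^sub>R b)"
      by (simp add: Vker_def algebra_simps)
    then have "norm (?U s - ?V s) = \<bar>vker a (s - h) - vker a s\<bar> * norm (g (x - s *\<^sub>R b))"
      by (simp only: norm_mult norm_of_real norm_cis mult_1_right)
    then show "norm (?U s - ?V s) \<le> \<bar>vker a (s - h) - vker a s\<bar> * B"
      using B by (simp add: mult_left_mono)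
  qed (use U V vker_shift_integrable vker_integrable in auto)
  also have "\<dots> = vmod (a * h) * B"
    using vmod_scale[OF a] by simp
  finally show ?thesis .
qed

text \<open>Shifting one coordinate at a time, the errors add up, since the phases collected on the
  way have modulus \<open>1\<close>.\<close>

lemma localized_shift_sum:
  assumes a: "0 < a" and g: "localized S a t g" and B: "\<And>x. norm (g x) \<le> B"
    and "finite A" "A \<subseteq> S"
  shows "norm (g (x - (\<Sum>b\<in>A. h b *\<^sub>R b)) - cis (- (\<Sum>b\<in>A. t b * h b)) * g x)
    \<le> (\<Sum>b\<in>A. vmod (a * h b)) * B"
  using assms(4,5)
proof (induction A)
  case (insert b A)
  let ?x = "x - (\<Sum>b\<in>A. h b *\<^sub>R b)"
  have 1: "norm (g (?x - h b *\<^sub>R b) - cis (- (t b * h b)) * g ?x) \<le> vmod (a * h b) * B"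
    using insert.prems g B by (intro localized_shift a) (auto simp: localized_def)
  have 2: "norm (g ?x - cis (- (\<Sum>b\<in>A. t b * h b)) * g x) \<le> (\<Sum>b\<in>A. vmod (a * h b)) * B"
    using insert by simp
  have eq: "g (x - (\<Sum>b\<in>insert b A. h b *\<^sub>R b)) - cis (- (\<Sum>b\<in>insert b A. t b * h b)) * g x
     = (g (?x - h b *\<^sub>R b) - cis (- (t b * h b)) * g ?x)
     + cis (- (t b * h b)) * (g ?x - cis (- (\<Sum>b\<in>A. t b * h b)) * g x)"
    using insert.hyps by (simp add: right_diff_distrib cis_mult mult.assoc[symmetric] add.commute diff_diff_eq)
  show ?case
    unfolding eq
    using norm_triangle_mono[OF 1, of "cis (- (t b * h b)) * (g ?x - cis (- (\<Sum>b\<in>A. t b * h b)) * g x)"] 2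
      insert.hyps
    by (simp add: norm_mult distrib_right)
qed simp

section \<open>Inverting convolution with the measure\<close>

abbreviation mconv :: "'a::euclidean_space measure \<Rightarrow> ('a \<Rightarrow> complex) \<Rightarrow> 'a \<Rightarrow> complex" where
  "mconv \<mu> \<equiv> cavg \<mu> (\<lambda>_. 1) (\<lambda>y. y)"

definition mconv_closure :: "'a::euclidean_space measure \<Rightarrow> ('a \<Rightarrow> complex) set" where
  "mconv_closure \<mu> = {g \<in> BUC. \<forall>e>0. \<exists>h\<in>BUC. \<forall>x. norm (g x - mconv \<mu> h x) \<le> e}"

locale borel_prob_space = prob_space \<mu> for \<mu> :: "'a::euclidean_space measure" +
  assumes sets_eq: "sets \<mu> = sets borel"
begin

lemma ident_measurable: "(\<lambda>y. y) \<in> borel_measurable \<mu>"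
  by (rule measurable_ident_sets[OF sets_eq])

lemma borel_imp_measurable: "f \<in> borel_measurable borel \<Longrightarrow> f \<in> borel_measurable \<mu>"
  using measurable_cong_sets[OF sets_eq refl] by blast

lemma one_integrable: "integrable \<mu> (\<lambda>_. 1 :: complex)"
  by simp

lemmas mconv_BUC = cavg_BUC[OF one_integrable ident_measurable]
lemmas mconv_add = cavg_add[OF one_integrable ident_measurable]

text \<open>The characteristic function is continuous by dominated convergence, so its modulus
  attains a minimum on a nonempty box, and that minimum is positive.\<close>

lemma char_fun_bounded_below:
  assumes "\<And>t. char_fun \<mu> t \<noteq> 0"
  obtains c where "0 < c" "\<And>t. t \<in> cbox u v \<Longrightarrow> c \<le> norm (char_fun \<mu> t)"
proof (cases "cbox u v = {}")
  case False
  have "continuous_on (cbox u v) (char_fun \<mu>)"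
    unfolding continuous_on_sequentially comp_def char_fun_def
  proof (intro allI ballI impI)
    fix t s assume "t \<in> cbox u v" "(\<forall>n. s n \<in> cbox u v) \<and> s \<longlonglongrightarrow> t"
    then have s: "s \<longlonglongrightarrow> t" by simp
    show "(\<lambda>n. CLINT x|\<mu>. iexp (s n \<bullet> x)) \<longlonglongrightarrow> (CLINT x|\<mu>. iexp (t \<bullet> x))"
    proof (rule integral_dominated_convergence[where w = "\<lambda>_. 1"])
      show "AE x in \<mu>. (\<lambda>n. iexp (s n \<bullet> x)) \<longlonglongrightarrow> iexp (t \<bullet> x)"
        using s by (intro AE_I2 tendsto_intros)
    qed (auto intro!: borel_imp_measurable)
  qed
  then have "continuous_on (cbox u v) (\<lambda>t. norm (char_fun \<mu> t))"
    by (rule continuous_on_norm)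
  from continuous_attains_inf[OF compact_cbox False this]
  obtain t0 where "\<And>t. t \<in> cbox u v \<Longrightarrow> norm (char_fun \<mu> t0) \<le> norm (char_fun \<mu> t)"
    by blast
  with assms show ?thesis by (intro that[of "norm (char_fun \<mu> t0)"]) auto
qed (use that[of 1] in simp)

lemma vmod_sum_integrable:
  "integrable \<mu> (\<lambda>y. \<Sum>b\<in>Basis. vmod (a * (y \<bullet> b)))"
  by (rule integrable_const_bound[where B = "\<Sum>b\<in>(Basis :: 'a set). 2 * (LINT u|lborel. \<bar>vker 1 u\<bar>)"])
    (auto intro!: AE_I2 borel_imp_measurable sum_mono vmod_le
      simp: sum_nonneg vmod_nonneg simp del: sum_constant)

text \<open>Dominated convergence again: \<open>vmod\<close> is bounded, so a constant is a majorant
  for the probability measure.\<close>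

lemma vmod_sum_tendsto_0:
  assumes "a \<longlonglongrightarrow> 0"
  shows "(\<lambda>n. LINT y|\<mu>. (\<Sum>b\<in>Basis. vmod (a n * (y \<bullet> b)))) \<longlonglongrightarrow> 0"
proof -
  have "(\<lambda>n. LINT y|\<mu>. (\<Sum>b\<in>Basis. vmod (a n * (y \<bullet> b)))) \<longlonglongrightarrow> (LINT y|\<mu>. 0)"
  proof (rule integral_dominated_convergence
      [where w = "\<lambda>_. \<Sum>b\<in>(Basis :: 'a set). 2 * (LINT u|lborel. \<bar>vker 1 u\<bar>)"])
    show "AE y in \<mu>. (\<lambda>n. \<Sum>b\<in>Basis. vmod (a n * (y \<bullet> b))) \<longlonglongrightarrow> 0"
      using assms by (intro AE_I2 tendsto_null_sum vmod_tendsto_0 tendsto_mult_left_zero)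
  qed (auto intro!: AE_I2 borel_imp_measurable sum_mono vmod_le
      simp: sum_nonneg vmod_nonneg simp del: sum_constant)
  then show ?thesis by simp
qed

text \<open>Integrates the shift estimate over \<mu>, with the coordinates of \<open>y\<close> as
  shifts. The frequency changes sign because convolution evaluates \<open>g\<close> at
  \<open>x - y\<close>.\<close>

lemma localized_mconv:
  assumes a: "0 < a" and g: "localized Basis a t g" and B: "\<And>x. norm (g x) \<le> B"
  shows "norm (mconv \<mu> g x - char_fun \<mu> (- (\<Sum>b\<in>Basis. t b *\<^sub>R b)) * g x)
    \<le> (LINT y|\<mu>. (\<Sum>b\<in>Basis. vmod (a * (y \<bullet> b)))) * B"
proof -
  let ?t = "- (\<Sum>b\<in>Basis. t b *\<^sub>R b)"
  have i1: "integrable \<mu> (\<lambda>y. iexp (?t \<bullet> y))"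
    by (rule integrable_const_bound[where B = 1]) (auto intro!: borel_imp_measurable)
  have i2: "integrable \<mu> (\<lambda>y. g (x - y))"
    using cavg_integrable[OF one_integrable ident_measurable localized_BUC[OF g]] by simp
  have "mconv \<mu> g x - char_fun \<mu> ?t * g x = (LINT y|\<mu>. g (x - y) - iexp (?t \<bullet> y) * g x)"
    using i1 i2 by (simp add: cavg_def char_fun_def)
  then have "norm (mconv \<mu> g x - char_fun \<mu> ?t * g x) \<le> (LINT y|\<mu>. norm (g (x - y) - iexp (?t \<bullet> y) * g x))"
    by (simp add: integral_norm_bound)
  also have "\<dots> \<le> (LINT y|\<mu>. (\<Sum>b\<in>Basis. vmod (a * (y \<bullet> b))) * B)"
  proof (rule integral_mono)
    fix y :: 'a
    have y: "(\<Sum>b\<in>Basis. (y \<bullet> b) *\<^sub>R b) = y" by (rule euclidean_representation)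
    have "iexp (?t \<bullet> y) = cis (- (\<Sum>b\<in>Basis. t b * (y \<bullet> b)))"
      by (simp add: cis_conv_exp inner_sum_left inner_commute[of y])
    then show "norm (g (x - y) - iexp (?t \<bullet> y) * g x) \<le> (\<Sum>b\<in>Basis. vmod (a * (y \<bullet> b))) * B"
      using localized_shift_sum[OF a g B finite_Basis order_refl, of x "\<lambda>b. y \<bullet> b"] by (simp only: y)
  qed (use i1 i2 vmod_sum_integrable in auto)
  finally show ?thesis by simp
qed

section \<open>The approximable functions form a closed subspace\<close>

lemma mconv_closureI:
  assumes "g \<in> BUC"
    and "\<And>e. 0 < e \<Longrightarrow> \<exists>h\<in>mconv_closure \<mu>. \<forall>x. norm (g x - h x) \<le> e"
  shows "g \<in> mconv_closure \<mu>"
  unfolding mconv_closure_def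
proof (intro CollectI conjI allI impI assms(1))
  fix e :: real assume "e > 0"
  then have "e / 2 > 0" by simp
  from assms(2)[OF this] obtain h where h: "h \<in> mconv_closure \<mu>" "\<And>x. norm (g x - h x) \<le> e / 2"
    by blast
  with \<open>e / 2 > 0\<close> obtain k where k: "k \<in> BUC" "\<And>x. norm (h x - mconv \<mu> k x) \<le> e / 2"
    unfolding mconv_closure_def by blast
  have "norm (g x - mconv \<mu> k x) \<le> e" for x
    using norm_triangle_mono[OF h(2)[of x] k(2)[of x]] by simp
  with k show "\<exists>h\<in>BUC. \<forall>x. norm (g x - mconv \<mu> h x) \<le> e" by blast
qed

lemma mconv_closure_cmult:
  assumes g: "g \<in> mconv_closure \<mu>"
  shows "(\<lambda>x. c * g x) \<in> mconv_closure \<mu>"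
  unfolding mconv_closure_def
proof (intro CollectI conjI allI impI)
  fix e :: real assume "e > 0"
  then have "0 < e / (norm c + 1)" by (simp add: add_nonneg_pos)
  with g obtain k where k: "k \<in> BUC" "\<And>x. norm (g x - mconv \<mu> k x) \<le> e / (norm c + 1)"
    unfolding mconv_closure_def by blast
  have "norm (c * g x - mconv \<mu> (\<lambda>x. c * k x) x) \<le> e" for x
  proof -
    have "norm (c * g x - mconv \<mu> (\<lambda>x. c * k x) x) = norm c * norm (g x - mconv \<mu> k x)"
      by (simp add: cavg_cmult norm_mult[symmetric] right_diff_distrib)
    also have "\<dots> \<le> (norm c + 1) * (e / (norm c + 1))"
      using k(2)[of x] by (intro mult_mono) auto
    finally show ?thesis by (simp add: add_nonneg_eq_0_iff)
  qed
  with BUC_cmult[OF k(1), of c] show "\<exists>h\<in>BUC. \<forall>x. norm (c * g x - mconv \<mu> h x) \<le> e" by blast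
qed (use g in \<open>simp add: mconv_closure_def BUC_cmult\<close>)

lemma mconv_closure_add:
  assumes f: "f \<in> mconv_closure \<mu>" and g: "g \<in> mconv_closure \<mu>"
  shows "(\<lambda>x. f x + g x) \<in> mconv_closure \<mu>"
  unfolding mconv_closure_def
proof (intro CollectI conjI allI impI)
  fix e :: real assume "e > 0"
  then have e: "e / 2 > 0" by simp
  from f e obtain h where h: "h \<in> BUC" "\<And>x. norm (f x - mconv \<mu> h x) \<le> e / 2"
    unfolding mconv_closure_def by blast
  from g e obtain k where k: "k \<in> BUC" "\<And>x. norm (g x - mconv \<mu> k x) \<le> e / 2"
    unfolding mconv_closure_def by blast
  have "norm (f x + g x - mconv \<mu> (\<lambda>x. h x + k x) x) \<le> e" for x
    using norm_triangle_mono[OF h(2)[of x] k(2)[of x]] h(1) k(1)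
    by (simp add: mconv_add algebra_simps)
  with BUC_add[OF h(1) k(1)] show "\<exists>h\<in>BUC. \<forall>x. norm (f x + g x - mconv \<mu> h x) \<le> e" by blast
qed (use f g in \<open>simp add: mconv_closure_def BUC_add\<close>)

lemma mconv_closure_sum:
  "(\<And>i. i \<in> I \<Longrightarrow> f i \<in> mconv_closure \<mu>) \<Longrightarrow> (\<lambda>x. \<Sum>i\<in>I. f i x) \<in> mconv_closure \<mu>"
proof (induction I rule: infinite_finite_induct)
  case (insert i I)
  then show ?case by (simp add: mconv_closure_add)
qed (auto simp: mconv_closure_def BUC_const cavg_def intro!: bexI[of _ "\<lambda>_. 0"])

text \<open>With \<open>\<lambda>\<close> the value of the characteristic function at the frequency where \<open>g\<close> is localized,
  the remainders \<open>r \<mapsto> r - (r * \<mu>) / \<lambda>\<close> stay localized and are halved in each step: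
  this is the Neumann series for the inverse of convolution with \<open>\<mu>\<close>.\<close>

lemma localized_in_closure:
  assumes a: "0 < a" and g: "localized Basis a t g"
    and nz: "char_fun \<mu> (- (\<Sum>b\<in>Basis. t b *\<^sub>R b)) \<noteq> 0"
    and small: "(LINT y|\<mu>. (\<Sum>b\<in>Basis. vmod (a * (y \<bullet> b))))
      \<le> norm (char_fun \<mu> (- (\<Sum>b\<in>Basis. t b *\<^sub>R b))) / 2"
  shows "g \<in> mconv_closure \<mu>"
proof -
  define l where "l = char_fun \<mu> (- (\<Sum>b\<in>Basis. t b *\<^sub>R b))"
  have l: "l \<noteq> 0" using nz by (simp add: l_def)
  obtain B where B: "0 \<le> B" "\<And>x. norm (g x) \<le> B" using BUC_bound localized_BUC[OF g] by blast
  have step: "\<exists>h\<in>BUC. \<exists>r. localized Basis a t r \<and> (\<forall>x. norm (r x) \<le> B / 2 ^ n)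
      \<and> (\<forall>x. g x = mconv \<mu> h x + r x)" for n
  proof (induction n)
    case 0
    show ?case
      using g B by (intro bexI[of _ "\<lambda>_. 0"] exI[of _ g]) (auto simp: cavg_def BUC_const)
  next
    case (Suc n)
    then obtain h r where h: "h \<in> BUC" and r: "localized Basis a t r"
      and rB: "\<And>x. norm (r x) \<le> B / 2 ^ n" and eq: "\<And>x. g x = mconv \<mu> h x + r x" by blast
    let ?r = "\<lambda>x. r x - (1 / l) * mconv \<mu> r x"
    have "localized Basis a t ?r"
      using r by (intro localized_diff_cmult localized_cavg ident_measurable) (auto intro: sigma_finite_measure_axioms)
    moreover have "norm (?r x) \<le> B / 2 ^ Suc n" for x
    proof -
      have "norm (l * ?r x) = norm (mconv \<mu> r x - l * r x)"
        using l by (simp add: right_diff_distrib norm_minus_commute)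
      also have "\<dots> \<le> (LINT y|\<mu>. (\<Sum>b\<in>Basis. vmod (a * (y \<bullet> b)))) * (B / 2 ^ n)"
        unfolding l_def by (rule localized_mconv[OF a r rB])
      also have "\<dots> \<le> (norm l / 2) * (B / 2 ^ n)"
        using small B(1) by (intro mult_right_mono) (auto simp: l_def)
      finally have "norm l * norm (?r x) \<le> norm l * (B / 2 ^ Suc n)"
        by (simp add: norm_mult)
      then show ?thesis by (rule mult_left_le_imp_le) (use l in simp)
    qed
    \<comment> \<open>The part \<open>mconv \<mu> r x / l\<close> subtracted from \<open>r\<close>
      is the convolution of \<open>r / l\<close>, which is added to \<open>h\<close>.\<close>
    moreover have "g x = mconv \<mu> (\<lambda>x. h x + (1 / l) * r x) x + ?r x" for x
      using eq[of x] mconv_add[OF h BUC_cmult[OF localized_BUC[OF r]], of "1 / l" x]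
        cavg_cmult[of \<mu> "\<lambda>_. 1" "\<lambda>y. y" "1 / l" r x] by simp
    moreover have "(\<lambda>x. h x + (1 / l) * r x) \<in> BUC"
      using h BUC_cmult[OF localized_BUC[OF r]] by (rule BUC_add)
    ultimately show ?case by blast
  qed
  show ?thesis
    unfolding mconv_closure_def
  proof (intro CollectI conjI allI impI localized_BUC[OF g])
    fix e :: real assume e: "e > 0"
    have "(\<lambda>n. B * (1 / 2) ^ n) \<longlonglongrightarrow> B * 0" by (intro tendsto_intros) auto
    then have "\<forall>\<^sub>F n in sequentially. B * (1 / 2) ^ n < e"
      using e by (intro order_tendstoD) auto
    then obtain n where n: "B / 2 ^ n < e"
      by (auto simp: eventually_sequentially power_one_over)
    from step[of n] obtain h r where h: "h \<in> BUC" and r: "\<And>x. norm (r x) \<le> B / 2 ^ n"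
      and eq: "\<And>x. g x = mconv \<mu> h x + r x"
      by blast
    have "norm (r x) \<le> e" for x using r[of x] n by linarith
    with h eq show "\<exists>h\<in>BUC. \<forall>x. norm (g x - mconv \<mu> h x) \<le> e"
      by (intro bexI[of _ h]) auto
  qed
qed

end

section \<open>Fejer means and density\<close>

text \<open>Take squared moduli in the geometric sum
  \<open>1 - z ^ m = (1 - z) * (\<Sum>j<m. z ^ j)\<close> with \<open>z = cis x\<close>, and expand
  the square of the sum.\<close>

lemma one_minus_cos_multiple:
  "complex_of_real (1 - cos (real m * x)) = of_real (1 - cos x) * (\<Sum>j<m. \<Sum>l<m. cis ((real j - real l) * x))"
proof -
  have norm_sq: "(norm (1 - cis y))\<^sup>2 = 2 * (1 - cos y)" for y
    by (simp add: cmod_def power2_eq_square algebra_simps sin_squared_eq[unfolded power2_eq_square])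
  let ?S = "\<Sum>j<m. cis (real j * x)"
  have "1 - cis (real m * x) = (1 - cis x) * ?S"
    unfolding Complex.DeMoivre[symmetric] by (rule one_diff_power_eq)
  then have "complex_of_real ((norm (1 - cis (real m * x)))\<^sup>2)
      = of_real ((norm (1 - cis x))\<^sup>2) * of_real ((norm ?S)\<^sup>2)"
    by (simp add: norm_mult power_mult_distrib)
  also have "of_real ((norm ?S)\<^sup>2) = ?S * cnj ?S"
    by (rule complex_norm_square)
  also have "\<dots> = (\<Sum>j<m. \<Sum>l<m. cis ((real j - real l) * x))"
    by (simp add: sum_product cis_cnj cis_mult left_diff_distrib)
  finally show ?thesis
    unfolding norm_sq by (simp only: of_real_mult of_real_numeral mult.assoc mult_cancel_left) simp
qed

text \<open>Splits a wide spectrum into pieces of width governed by \<open>a\<close>, centred at the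
  multiples \<open>(j - l) * a\<close>. The factor \<open>1 / m\<close> compares the normalizations
  of the two orders.\<close>

lemma Wker_eq_sum_modulated:
  assumes "0 < m"
  shows "Wker (real m * a) 0 s = (\<Sum>(j, l)\<in>{..<m} \<times> {..<m}. (1 / of_nat m) * Wker a ((real j - real l) * a) s)"
proof -
  have "Wker (real m * a) 0 s
      = of_real (1 - cos (real m * (a * s))) / (of_real (s\<^sup>2) * of_real (pi * (real m * a)))"
    by (simp add: Wker_def fker_def mult.assoc)
  also have "of_real (1 - cos (real m * (a * s)))
      = of_real (1 - cos (a * s)) * (\<Sum>j<m. \<Sum>l<m. cis ((real j - real l) * (a * s)))"
    by (rule one_minus_cos_multiple)
  also have "of_real (1 - cos (a * s)) * (\<Sum>j<m. \<Sum>l<m. cis ((real j - real l) * (a * s)))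
        / (of_real (s\<^sup>2) * of_real (pi * (real m * a)))
      = (\<Sum>j<m. \<Sum>l<m. (1 / of_nat m) * Wker a ((real j - real l) * a) s)"
    by (simp add: Wker_def fker_def sum_distrib_left sum_divide_distrib mult.assoc mult_ac)
  finally show ?thesis by (simp only: sum.cartesian_product)
qed

lemma dconv_BUC: "f \<in> BUC \<Longrightarrow> dconv (Wker a t) b f \<in> BUC"
  by (rule cavg_BUC[OF Wker_integrable]) simp_all

lemma dconv_Wker_sum:
  assumes m: "0 < m" and f: "f \<in> BUC"
  shows "dconv (Wker (real m * a) 0) b f
    = (\<lambda>x. \<Sum>p\<in>{..<m} \<times> {..<m}. (1 / of_nat m) * dconv (Wker a ((real (fst p) - real (snd p)) * a)) b f x)"
proof
  fix x
  let ?w = "\<lambda>p. Wker a ((real (fst p) - real (snd p)) * a)"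
  have "Wker (real m * a) 0 = (\<lambda>s. \<Sum>p\<in>{..<m} \<times> {..<m}. (1 / of_nat m) * ?w p s)"
    by (rule ext, subst Wker_eq_sum_modulated[OF m]) (simp add: case_prod_unfold)
  then have "dconv (Wker (real m * a) 0) b f x
      = (\<Sum>p\<in>{..<m} \<times> {..<m}. dconv (\<lambda>s. (1 / of_nat m) * ?w p s) b f x)"
    by (simp only:) (rule cavg_weight_sum[OF integrable_mult_right[OF Wker_integrable] _ f], simp)
  also have "\<dots> = (\<Sum>p\<in>{..<m} \<times> {..<m}. (1 / of_nat m) * dconv (?w p) b f x)"
    unfolding cavg_def mult.assoc integral_mult_right_zero ..
  finally show "dconv (Wker (real m * a) 0) b f x
    = (\<Sum>p\<in>{..<m} \<times> {..<m}. (1 / of_nat m) * dconv (?w p) b f x)" .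
qed

section \<open>Fejer means in several coordinates\<close>

abbreviation fejer_conv :: "real \<Rightarrow> 'a::euclidean_space list \<Rightarrow> ('a \<Rightarrow> complex) \<Rightarrow> 'a \<Rightarrow> complex" where
  "fejer_conv N \<equiv> fold (dconv (Wker N 0))"

lemma fejer_conv_cmult: "fejer_conv N bs (\<lambda>x. c * f x) = (\<lambda>x. c * fejer_conv N bs f x)"
proof (induction bs arbitrary: f)
  case (Cons b bs)
  have "dconv (Wker N 0) b (\<lambda>x. c * f x) = (\<lambda>x. c * dconv (Wker N 0) b f x)"
    by (rule ext) (rule cavg_cmult)
  with Cons show ?case by simp
qed simp

lemma fejer_conv_sum:
  assumes "\<And>i. i \<in> I \<Longrightarrow> f i \<in> BUC"
  shows "fejer_conv N bs (\<lambda>x. \<Sum>i\<in>I. f i x) = (\<lambda>x. \<Sum>i\<in>I. fejer_conv N bs (f i) x)"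
  using assms
proof (induction bs arbitrary: f)
  case (Cons b bs)
  have "dconv (Wker N 0) b (\<lambda>x. \<Sum>i\<in>I. f i x) = (\<lambda>x. \<Sum>i\<in>I. dconv (Wker N 0) b (f i) x)"
    by (rule ext, rule cavg_sum[OF Wker_integrable]) (use Cons.prems in auto)
  with Cons show ?case by (simp add: dconv_BUC)
qed simp

lemma fejer_conv_diff:
  assumes "f \<in> BUC" "g \<in> BUC"
  shows "fejer_conv N bs (\<lambda>x. f x - g x) = (\<lambda>x. fejer_conv N bs f x - fejer_conv N bs g x)"
  using assms
proof (induction bs arbitrary: f g)
  case (Cons b bs)
  have "dconv (Wker N 0) b (\<lambda>x. f x - g x) = (\<lambda>x. dconv (Wker N 0) b f x - dconv (Wker N 0) b g x)"
    by (rule ext, rule cavg_diff[OF Wker_integrable]) (use Cons.prems in auto)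
  with Cons show ?case by (simp add: dconv_BUC)
qed simp

lemma Wker_0: "0 < N \<Longrightarrow> Wker N 0 s = of_real (fker N s / (pi * N))"
  by (simp add: Wker_def)

lemma Wker_norm_integral: "0 < N \<Longrightarrow> (LINT s|lborel. norm (Wker N 0 s)) = 1"
  unfolding Wker_0 norm_of_real by (simp add: fker_nonneg fker_integral)

text \<open>Each kernel is nonnegative with integral \<open>1\<close>, so each smoothing step is a
  contraction in the supremum norm.\<close>

lemma fejer_conv_norm_le:
  assumes "0 < N" "f \<in> BUC" "\<And>x. norm (f x) \<le> B"
  shows "norm (fejer_conv N bs f x) \<le> B"
  using assms(2,3)
proof (induction bs arbitrary: f)
  case (Cons b bs)
  have "norm (dconv (Wker N 0) b f x) \<le> B" for x
    using cavg_norm_le[OF Wker_integrable[of N 0] _ Cons.prems, of "\<lambda>s. s *\<^sub>R b" x]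
      Wker_norm_integral[OF assms(1)] by simp
  with Cons show ?case by (simp add: dconv_BUC)
qed simp

text \<open>Approximate identity: uniform continuity handles \<open>\<bar>s\<bar> < d\<close>;
  elsewhere \<open>fker N s \<le> 2 / s\<^sup>2\<close> holds uniformly in \<open>N\<close>, and the
  normalization supplies a factor \<open>1 / N\<close>.\<close>

lemma dconv_Wker_approx:
  assumes f: "f \<in> BUC" and b: "norm b = 1" and e: "0 < e"
  shows "\<exists>N0>0. \<forall>N\<ge>N0. \<forall>x. norm (dconv (Wker N 0) b f x - f x) \<le> e"
proof -
  obtain B where B: "0 \<le> B" "\<And>x. norm (f x) \<le> B" using BUC_bound f by blast
  obtain d where d: "0 < d" "\<And>x y. dist x y < d \<Longrightarrow> norm (f x - f y) < e / 2"
    using BUC_uniform[OF f, of "e / 2"] e by auto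
  \<comment> \<open>For \<open>\<bar>s\<bar> \<ge> d\<close> the kernel is at most
    \<open>2 * (1 + 1 / d\<^sup>2) / (1 + s\<^sup>2) / (pi * N)\<close>, and the increment of
    \<open>f\<close> at most \<open>2 * B\<close>.\<close>
  define C where "C = 2 * B * (2 * (1 + 1 / d\<^sup>2)) / pi"
  define J where "J = (LINT s|lborel. 1 / (1 + s\<^sup>2) :: real)"
  have C: "0 \<le> C" using B(1) by (simp add: C_def)
  have J: "0 \<le> J" by (simp add: J_def)
  have bound: "norm (dconv (Wker N 0) b f x - f x) \<le> e / 2 + C * J / N" if N: "0 < N" for N x
  proof -
    let ?K = "\<lambda>s. fker N s / (pi * N)"
    have K: "integrable lborel ?K" using fker_integrable by simp
    have K1: "(LINT s|lborel. ?K s) = 1" using N by (simp add: fker_integral)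
    have Kc: "integrable lborel (\<lambda>s. complex_of_real (?K s))"
      using integrable_of_real[OF K] .
    have i1: "integrable lborel (\<lambda>s. of_real (?K s) * f (x - s *\<^sub>R b))"
      by (rule cavg_integrable[OF Kc _ f]) simp
    have i2: "integrable lborel (\<lambda>s. of_real (?K s) * f x)"
      using Kc by (rule integrable_mult_left)
    have iK: "integrable lborel (\<lambda>s. e / 2 * ?K s)"
      using K by (rule integrable_mult_right)
    have iJ: "integrable lborel (\<lambda>s. C / N * (1 / (1 + s\<^sup>2)))"
      using inverse_1_plus_square_integrable by (rule integrable_mult_right)
    have "dconv (Wker N 0) b f x - f x
        = (LINT s|lborel. of_real (?K s) * f (x - s *\<^sub>R b)) - of_real (LINT s|lborel. ?K s) * f x"
      unfolding K1 by (simp add: cavg_def Wker_def)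
    also have "\<dots> = (LINT s|lborel. of_real (?K s) * f (x - s *\<^sub>R b) - of_real (?K s) * f x)"
      unfolding Bochner_Integration.integral_diff[OF i1 i2]
      by (simp only: integral_mult_left_zero integral_complex_of_real)
    finally have "norm (dconv (Wker N 0) b f x - f x)
        \<le> (LINT s|lborel. norm (of_real (?K s) * f (x - s *\<^sub>R b) - of_real (?K s) * f x))"
      by (simp only: integral_norm_bound)
    also have "\<dots> \<le> (LINT s|lborel. e / 2 * ?K s + C / N * (1 / (1 + s\<^sup>2)))"
    proof (rule integral_mono[OF integrable_norm[OF Bochner_Integration.integrable_diff[OF i1 i2]]
          Bochner_Integration.integrable_add[OF iK iJ]])
      fix s
      have K0: "0 \<le> ?K s" using N fker_nonneg[of N s] by simp
      have eq: "norm (of_real (?K s) * f (x - s *\<^sub>R b) - of_real (?K s) * f x)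
          = ?K s * norm (f (x - s *\<^sub>R b) - f x)"
        by (simp only: right_diff_distrib[symmetric] norm_mult norm_of_real abs_of_nonneg[OF K0])
      show "norm (of_real (?K s) * f (x - s *\<^sub>R b) - of_real (?K s) * f x)
          \<le> e / 2 * ?K s + C / N * (1 / (1 + s\<^sup>2))"
      proof (cases "\<bar>s\<bar> < d")
        case True
        then have "norm (f (x - s *\<^sub>R b) - f x) \<le> e / 2"
          using d(2)[of "x - s *\<^sub>R b" x] b by (simp add: dist_norm)
        from mult_left_mono[OF this K0] have "?K s * norm (f (x - s *\<^sub>R b) - f x) \<le> e / 2 * ?K s"
          by (simp only: mult.commute)
        moreover have "0 \<le> C / N * (1 / (1 + s\<^sup>2))" using C N by simp
        ultimately show ?thesis unfolding eq by linarith
      next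
        case False
        then have s: "d\<^sup>2 \<le> s\<^sup>2" "s \<noteq> 0" using d(1) abs_le_square_iff[of d s] by auto
        have "norm (f (x - s *\<^sub>R b) - f x) \<le> 2 * B"
          using norm_triangle_ineq4[of "f (x - s *\<^sub>R b)" "f x"] B(2)[of "x - s *\<^sub>R b"] B(2)[of x] by simp
        then have "?K s * norm (f (x - s *\<^sub>R b) - f x) \<le> ?K s * (2 * B)"
          using K0 by (rule mult_left_mono)
        also have "\<dots> \<le> (2 * (1 + 1 / d\<^sup>2) / (1 + s\<^sup>2)) / (pi * N) * (2 * B)"
        proof -
          have "1 \<le> s\<^sup>2 / d\<^sup>2" using s d(1) by simp
          then have "1 / s\<^sup>2 \<le> (1 + 1 / d\<^sup>2) / (1 + s\<^sup>2)"
            using s by (simp add: divide_le_eq pos_le_divide_eq add_pos_nonneg distrib_right)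
          with fker_le[of N s] have "fker N s \<le> 2 * (1 + 1 / d\<^sup>2) / (1 + s\<^sup>2)"
            by (simp only: times_divide_eq_right[symmetric])
          then show ?thesis using N B(1) by (intro mult_right_mono divide_right_mono) auto
        qed
        also have "\<dots> = C / N * (1 / (1 + s\<^sup>2))" by (simp add: C_def mult_ac)
        also have "\<dots> \<le> e / 2 * ?K s + C / N * (1 / (1 + s\<^sup>2))"
          using mult_nonneg_nonneg[of "e / 2", OF _ K0] e by (simp only: le_add_same_cancel2)
        finally show ?thesis unfolding eq .
      qed
    qed
    also have "\<dots> = e / 2 * (LINT s|lborel. ?K s) + C / N * J"
      unfolding J_def Bochner_Integration.integral_add[OF iK iJ] integral_mult_right_zero ..
    finally show ?thesis unfolding K1 by simp
  qed
  \<comment> \<open>Makes \<open>C * J / N \<le> e / 2\<close>; the summand \<open>1\<close> keeps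
    \<open>N0\<close> positive when \<open>C * J = 0\<close>.\<close>
  define N0 where "N0 = 2 * C * J / e + 1"
  have "0 < N0" using C J e by (simp add: N0_def add_nonneg_pos)
  moreover have "norm (dconv (Wker N 0) b f x - f x) \<le> e" if "N0 \<le> N" for N x
  proof -
    have N: "0 < N" using \<open>0 < N0\<close> that by simp
    have "2 * C * J / e \<le> N" using that by (simp add: N0_def)
    then have "C * J / N \<le> e / 2" using e N by (simp add: field_simps)
    with bound[OF N, of x] show ?thesis by linarith
  qed
  ultimately show ?thesis by blast
qed

text \<open>The error of smoothing along \<open>b\<close> passes through the remaining directions
  without growing, by contraction, and is added to their own error on \<open>f\<close>.\<close>

lemma fejer_conv_approx:
  assumes "f \<in> BUC" "set bs \<subseteq> Basis" "0 < e"
  shows "\<exists>N0>0. \<forall>N\<ge>N0. \<forall>x. norm (fejer_conv N bs f x - f x) \<le> e"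
  using assms(2,3)
proof (induction bs arbitrary: e)
  case (Cons b bs)
  from Cons.IH[of "e / 2"] Cons.prems obtain N1 where N1: "0 < N1"
    "\<And>N x. N1 \<le> N \<Longrightarrow> norm (fejer_conv N bs f x - f x) \<le> e / 2" by auto
  have b: "norm b = 1" using Cons.prems by simp
  from dconv_Wker_approx[OF assms(1) b, of "e / 2"] Cons.prems obtain N2 where N2: "0 < N2"
    "\<And>N x. N2 \<le> N \<Longrightarrow> norm (dconv (Wker N 0) b f x - f x) \<le> e / 2" by auto
  have "norm (fejer_conv N (b # bs) f x - f x) \<le> e" if N: "max N1 N2 \<le> N" for N x
  proof -
    have "norm (fejer_conv N bs (\<lambda>x. dconv (Wker N 0) b f x - f x) x) \<le> e / 2"
      by (rule fejer_conv_norm_le) (use N N1 N2 assms(1) in \<open>auto simp: BUC_diff dconv_BUC\<close>)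
    moreover have "fejer_conv N bs (\<lambda>x. dconv (Wker N 0) b f x - f x)
        = (\<lambda>x. fejer_conv N bs (dconv (Wker N 0) b f) x - fejer_conv N bs f x)"
      by (rule fejer_conv_diff) (use assms(1) in \<open>simp_all add: dconv_BUC\<close>)
    ultimately have "norm (fejer_conv N bs (dconv (Wker N 0) b f) x - fejer_conv N bs f x) \<le> e / 2"
      by simp
    from norm_triangle_mono[OF this N1(2)[of N x]] show ?thesis using N by simp
  qed
  with N1(1) show ?case by (intro exI[of _ "max N1 N2"]) auto
qed (auto intro: exI[of _ 1])

section \<open>Decomposition of Fejer means into localized pieces\<close>

context borel_prob_space
begin

text \<open>Induction over the directions still to be smoothed, with \<open>t\<close> recording the
  frequencies already fixed. Each direction splits the mean into \<open>m * m\<close> pieces; with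
  none left, a piece is localized in all coordinates at a frequency in the cube, where
  \<open>c\<close> applies.\<close>

lemma fejer_conv_in_closure_of_small:
  assumes nz: "\<And>t. char_fun \<mu> t \<noteq> 0"
    and a: "0 < a" and m: "0 < m"
    and c: "\<And>t. t \<in> cbox (- (\<Sum>b\<in>Basis. (real m * a) *\<^sub>R b)) (\<Sum>b\<in>Basis. (real m * a) *\<^sub>R b)
      \<Longrightarrow> c \<le> norm (char_fun \<mu> t)"
    and small: "(LINT y|\<mu>. (\<Sum>b\<in>Basis. vmod (a * (y \<bullet> b)))) \<le> c / 2"
    and "distinct bs" "set bs \<subseteq> Basis" "f \<in> BUC" "localized (Basis - set bs) a t f"
    and "\<And>b. b \<in> Basis - set bs \<Longrightarrow> \<bar>t b\<bar> \<le> real m * a"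
  shows "fejer_conv (real m * a) bs f \<in> mconv_closure \<mu>"
  using assms(6-)
proof (induction bs arbitrary: f t)
  case Nil
  let ?t = "- (\<Sum>b\<in>Basis. t b *\<^sub>R b)"
  have "?t \<in> cbox (- (\<Sum>b\<in>Basis. (real m * a) *\<^sub>R b)) (\<Sum>b\<in>Basis. (real m * a) *\<^sub>R b)"
    using Nil.prems(5) by (auto simp: mem_box abs_le_iff minus_le_iff)
  from c[OF this] small have "(LINT y|\<mu>. (\<Sum>b\<in>Basis. vmod (a * (y \<bullet> b)))) \<le> norm (char_fun \<mu> ?t) / 2"
    by simp
  with Nil show ?case
    by (simp add: localized_in_closure[OF a _ nz])
next
  case (Cons b bs)
  let ?N = "real m * a"
  let ?k = "\<lambda>p. (real (fst p) - real (snd p)) * a"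
  let ?I = "{..<m} \<times> {..<m}"
  have eq: "Basis - set bs = insert b (Basis - set (b # bs))" using Cons.prems by auto
  have mem: "fejer_conv ?N bs (dconv (Wker a (?k p)) b f) \<in> mconv_closure \<mu>" if p: "p \<in> ?I" for p
  proof (rule Cons.IH)
    show "localized (Basis - set bs) a (t(b := ?k p)) (dconv (Wker a (?k p)) b f)"
      unfolding eq using Cons.prems by (intro localized_insert a) auto
    have "\<bar>real (fst p) - real (snd p)\<bar> \<le> real m" using p by (auto simp: abs_le_iff)
    then have "\<bar>?k p\<bar> \<le> ?N" using a by (simp add: abs_mult mult_right_mono)
    then show "\<bar>(t(b := ?k p)) b'\<bar> \<le> ?N" if "b' \<in> Basis - set bs" for b'
      using Cons.prems(5) that by auto
  qed (use Cons.prems in \<open>auto simp: dconv_BUC\<close>)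
  have "fejer_conv ?N (b # bs) f
      = (\<lambda>x. \<Sum>p\<in>?I. (1 / of_nat m) * fejer_conv ?N bs (dconv (Wker a (?k p)) b f) x)"
    using Cons.prems(3)
    by (simp only: fold_Cons comp_apply dconv_Wker_sum[OF m] fejer_conv_sum[OF BUC_cmult[OF dconv_BUC]]
        fejer_conv_cmult)
  also have "\<dots> \<in> mconv_closure \<mu>"
    by (rule mconv_closure_sum, rule mconv_closure_cmult) (rule mem)
  finally show ?case .
qed

text \<open>The cube, and with it \<open>c\<close>, depends on \<open>N\<close> only. It is fixed
  first; then the width \<open>N / Suc n\<close> is made so small that the error is below
  \<open>c / 2\<close> for all pieces at once.\<close>

lemma fejer_conv_in_closure:
  assumes nz: "\<And>t. char_fun \<mu> t \<noteq> 0"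
    and "0 < N" "f \<in> BUC" "distinct bs" "set bs = Basis"
  shows "fejer_conv N bs f \<in> mconv_closure \<mu>"
proof -
  obtain c where c: "0 < c" "\<And>t. t \<in> cbox (- (\<Sum>b\<in>Basis. N *\<^sub>R b)) (\<Sum>b\<in>Basis. N *\<^sub>R b)
      \<Longrightarrow> c \<le> norm (char_fun \<mu> t)"
    using char_fun_bounded_below[OF nz] by blast
  have "(\<lambda>n. N / real (Suc n)) \<longlonglongrightarrow> 0"
    by (intro real_tendsto_divide_at_top[OF tendsto_const]
        filterlim_compose[OF filterlim_real_sequentially filterlim_Suc])
  from vmod_sum_tendsto_0[OF this]
  have "\<forall>\<^sub>F n in sequentially. (LINT y|\<mu>. (\<Sum>b\<in>Basis. vmod (N / real (Suc n) * (y \<bullet> b)))) < c / 2"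
    using c(1) by (intro order_tendstoD) auto
  then obtain n where n: "(LINT y|\<mu>. (\<Sum>b\<in>Basis. vmod (N / real (Suc n) * (y \<bullet> b)))) < c / 2"
    by (auto simp: eventually_sequentially)
  have N: "real (Suc n) * (N / real (Suc n)) = N" by simp
  have "fejer_conv (real (Suc n) * (N / real (Suc n))) bs f \<in> mconv_closure \<mu>"
    \<comment> \<open>Before any smoothing no coordinate is localized, so every \<open>t\<close>
      would do.\<close>
    by (rule fejer_conv_in_closure_of_small[where c = c and t = "\<lambda>_. 0"], unfold N)
      (use assms c n in \<open>auto simp: localized_def less_imp_le\<close>)
  then show ?thesis unfolding N .
qed

lemma mconv_dense:
  assumes nz: "\<And>t. char_fun \<mu> t \<noteq> 0" and f: "f \<in> BUC"
  shows "f \<in> mconv_closure \<mu>"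
proof (rule mconv_closureI[OF f])
  fix e :: real assume e: "e > 0"
  obtain bs :: "'a list" where bs: "distinct bs" "set bs = Basis"
    using finite_distinct_list[OF finite_Basis] by blast
  from fejer_conv_approx[OF f _ e, of bs] bs obtain N where N: "0 < N"
    "\<forall>x. norm (fejer_conv N bs f x - f x) \<le> e" by auto
  with fejer_conv_in_closure[OF nz N(1) f bs]
  show "\<exists>h\<in>mconv_closure \<mu>. \<forall>x. norm (f x - h x) \<le> e"
    by (intro bexI[of _ "fejer_conv N bs f"]) (simp_all add: norm_minus_commute)
qed

end

section \<open>Return to real functions\<close>

lemma U_b_imp_BUC:
  assumes "f \<in> U_b"
  shows "(\<lambda>x. complex_of_real (f x)) \<in> BUC"
  using bounded_linear.uniformly_continuous_on[OF bounded_linear_of_real, of UNIV f]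
    bounded_linear_image[OF _ bounded_linear_of_real, of "range f"] assms
  by (simp add: U_b_def BUC_def image_image)

lemma Re_BUC:
  assumes "f \<in> BUC"
  shows "(\<lambda>x. Re (f x)) \<in> U_b"
  using bounded_linear.uniformly_continuous_on[OF bounded_linear_Re, of UNIV f]
    bounded_linear_image[OF _ bounded_linear_Re, of "range f"] assms
  by (simp add: U_b_def BUC_def image_image)

context borel_prob_space
begin

lemma conv_measure_Re:
  assumes "f \<in> BUC"
  shows "conv_measure (\<lambda>x. Re (f x)) \<mu> x = Re (mconv \<mu> f x)"
  using integral_Re[OF cavg_integrable[OF one_integrable ident_measurable assms, of x]]
  by (simp add: conv_measure_def cavg_def)

lemma conv_measure_U_b:
  assumes "f \<in> U_b"
  shows "conv_measure f \<mu> \<in> U_b"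
proof -
  have "conv_measure f \<mu> = (\<lambda>x. Re (mconv \<mu> (\<lambda>x. of_real (f x)) x))"
    using conv_measure_Re[OF U_b_imp_BUC[OF assms]] by (simp add: fun_eq_iff)
  then show ?thesis
    using Re_BUC[OF mconv_BUC[OF U_b_imp_BUC[OF assms]]] by simp
qed

text \<open>Convolution with \<mu> commutes with taking real parts, and real parts do not increase
  distances.\<close>

lemma conv_measure_dense:
  assumes "\<And>t. char_fun \<mu> t \<noteq> 0" "f \<in> U_b" "0 < e"
  obtains g where "g \<in> U_b" "\<And>x. \<bar>f x - conv_measure g \<mu> x\<bar> \<le> e"
proof -
  have "(\<lambda>x. complex_of_real (f x)) \<in> mconv_closure \<mu>"
    by (rule mconv_dense[OF assms(1) U_b_imp_BUC[OF assms(2)]])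
  with assms(3) obtain h where h: "h \<in> BUC" "\<And>x. norm (of_real (f x) - mconv \<mu> h x) \<le> e"
    unfolding mconv_closure_def by blast
  show ?thesis
  proof (rule that[of "\<lambda>x. Re (h x)"])
    show "\<bar>f x - conv_measure (\<lambda>x. Re (h x)) \<mu> x\<bar> \<le> e" for x
      using h(2)[of x] abs_Re_le_cmod[of "of_real (f x) - mconv \<mu> h x"]
      by (simp add: conv_measure_Re[OF h(1)])
  qed (rule Re_BUC[OF h(1)])
qed

end

section \<open>From uniform approximation to the closure in \<open>U_b_topology\<close>\<close>

lemma U_b_topology_closure_eqI:
  assumes S: "S \<subseteq> U_b"
    and dense: "\<And>f e. f \<in> U_b \<Longrightarrow> 0 < e \<Longrightarrow> \<exists>g\<in>S. \<forall>x. \<bar>f x - g x\<bar> \<le> e"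
  shows "U_b_topology closure_of S = (U_b :: ('a::euclidean_space \<Rightarrow> real) set)"
proof -
  let ?m = "submetric (funspace UNIV euclidean_metric) (U_b :: ('a \<Rightarrow> real) set)"
  interpret m: Metric_space "mspace ?m" "mdist ?m" by (rule Metric_space_mspace_mdist)
  have top: "U_b_topology = m.mtopology"
    by (simp add: U_b_topology_def mtopology_of_def)
  have space: "mspace ?m = (U_b :: ('a \<Rightarrow> real) set)"
    using topspace_U_b_topology unfolding U_b_topology_def by simp
  have "\<exists>g\<in>S. g \<in> m.mball f r" if f: "f \<in> U_b" and r: "0 < r" for f :: "'a \<Rightarrow> real" and r :: real
  proof -
    obtain g where g: "g \<in> S" "\<And>x. \<bar>f x - g x\<bar> \<le> r / 2"
      using dense[OF f, of "r / 2"] r by auto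
    have "g \<in> U_b" using g S by blast
    \<comment> \<open>Half the radius, because the supremum inherits only a non-strict bound and the
      ball is open.\<close>
    have "mdist ?m f g \<le> r / 2"
      unfolding mdist_U_b[OF f \<open>g \<in> U_b\<close>] using g(2) by (intro cSUP_least) auto
    then have "g \<in> m.mball f r"
      unfolding m.in_mball unfolding space using f r \<open>g \<in> U_b\<close> by (intro conjI) linarith+
    with g(1) show ?thesis by blast
  qed
  then show ?thesis
    unfolding top m.metric_closure_of using space by (auto simp: Bex_def)
qed

theorem propositionC1:
  fixes \<mu> :: "(real ^ 'n) measure"
  assumes "prob_space \<mu>"
    and "sets \<mu> = sets borel"
    and "\<And>t. char_fun \<mu> t \<noteq> 0"
  shows "{conv_measure f \<mu> | f. f \<in> U_b} \<subseteq> U_b \<and>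
         U_b_topology closure_of {conv_measure f \<mu> | f. f \<in> U_b} = U_b"
proof
  interpret borel_prob_space \<mu>
    by (intro borel_prob_space.intro borel_prob_space_axioms.intro assms(1,2))
  show sub: "{conv_measure f \<mu> | f. f \<in> U_b} \<subseteq> U_b"
    using conv_measure_U_b by blast
  show "U_b_topology closure_of {conv_measure f \<mu> | f. f \<in> U_b} = U_b"
  proof (rule U_b_topology_closure_eqI[OF sub])
    fix f :: "real ^ 'n \<Rightarrow> real" and e :: real
    assume "f \<in> U_b" "0 < e"
    then obtain g where "g \<in> U_b" "\<And>x. \<bar>f x - conv_measure g \<mu> x\<bar> \<le> e"
      using conv_measure_dense[OF assms(3)] by metis
    then show "\<exists>g\<in>{conv_measure f \<mu> | f. f \<in> U_b}. \<forall>x. \<bar>f x - g x\<bar> \<le> e" by blast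
  qed
qed

end
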